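(* Let $n\ge1$ and $r=\lfloor n/2\rfloor+1$. Every $n\times n$ complex matrix can be expressed as a product of $4r+1$ Toeplitz matrices, and every $n\times n$ complex matrix can be expressed as a product of $4r+1$ Hankel matrices.
   Context: All factors are $n\times n$ with complex entries. A matrix $(a_{ij})$ is Toeplitz if $a_{ij}$ depends only on $j-i$, and Hankel if $a_{ij}$ depends only on $i+j$. *)

theory Defs
  imports Complex_Main "Jordan_Normal_Form.Matrix"
begin

(* Indices of the matrix type run from 0 rather than 1; being Toeplitz or Hankel is
   insensitive to this shift. The difference j - i is taken in int, since
   subtraction on nat would truncate. *)

definition toeplitz_mat :: "'a mat \<Rightarrow> bool" where
  "toeplitz_mat A \<longleftrightarrow>
     (\<exists>f :: int \<Rightarrow> 'a. \<forall>i < dim_row A. \<forall>j < dim_col A. A $$ (i, j) = f (int j - int i))"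

definition hankel_mat :: "'a mat \<Rightarrow> bool" where
  "hankel_mat A \<longleftrightarrow>
     (\<exists>f :: nat \<Rightarrow> 'a. \<forall>i < dim_row A. \<forall>j < dim_col A. A $$ (i, j) = f (i + j))"

(* The type of matrices has no unit common to all dimensions, so prod_list does not
   apply; the dimension n of the unit is passed explicitly. *)

definition mat_prod_list :: "nat \<Rightarrow> 'a :: semiring_1 mat list \<Rightarrow> 'a mat" where
  "mat_prod_list n As = foldr (*) As (1\<^sub>m n)"

end

theory Submission
  imports Defs "Jordan_Normal_Form.Determinant" "Jordan_Normal_Form.Column_Operations"
    "HOL-Computational_Algebra.Fundamental_Theorem_Algebra"
begin

text \<open>
  The heart of the matter is that a generic matrix is a product of \<open>r = n div 2 + 1\<close> Toeplitz
  matrices (\<open>generic_toeplitz_product\<close>): there is a nonzero polynomial \<open>q\<close> in the entries such that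
  every matrix with \<open>q \<noteq> 0\<close> is such a product. The rest follows from it. If \<open>A\<close> is invertible, then
  for a generic \<open>X\<close> both \<open>X\<close> and the inverse of \<open>X\<close> times \<open>A\<close> avoid the zero set of \<open>q\<close>, so \<open>A\<close> is a
  product of \<open>2 * r\<close> Toeplitz matrices (\<open>invertible_toeplitz_product\<close>). An arbitrary matrix of rank
  \<open>k\<close> is \<open>P * E * Q\<close> with \<open>P\<close> and \<open>Q\<close> invertible, where \<open>E\<close> may be any matrix of rank \<open>k\<close>, in
  particular the Toeplitz matrix with \<open>k\<close> ones on one superdiagonal (\<open>toeplitz_product_all\<close>).
  The exchange matrix \<open>J\<close> satisfies \<open>J * J = 1\<close>, and \<open>T * J\<close> and \<open>J * T\<close> are Hankel when \<open>T\<close> is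
  Toeplitz. So a factorization of \<open>A * J\<close> into an odd number of Toeplitz matrices becomes one of
  \<open>A\<close> into Hankel matrices, by inserting \<open>J * J\<close> at every second place.

  The generic statement has two parts. First, the set of products of \<open>r\<close> Toeplitz matrices is
  the projection of a set defined by polynomial equations, hence constructible by elimination of
  quantifiers over the complex numbers (\<open>constructible_projection\<close>). A constructible set
  either contains the complement of a hypersurface or is contained in a hypersurface
  (\<open>constructible_dichotomy\<close>). Second, the latter does not happen: a polynomial that vanishes on all
  products vanishes everywhere (\<open>vanishes_on_products_imp_zero\<close>). For this, take the factors

    \<open>1 + t B\<^sub>k + t\<^sup>2 (Y\<^sub>k\<^sub>+\<^sub>1 - Y\<^sub>k) + t\<^sup>3 X\<^sub>k\<close>  for  \<open>k = 0, ..., m\<close>  with  \<open>m = n div 2\<close>,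

  where the Toeplitz matrices \<open>B\<^sub>k\<close> are fixed, \<open>X\<^sub>k\<close> and \<open>Y\<^sub>k\<close> are arbitrary Toeplitz, and
  \<open>Y\<^sub>0 = Y\<^sub>m\<^sub>+\<^sub>1 = 0\<close>. The terms of order \<open>t\<^sup>2\<close> telescope to zero, so relative to the product
  \<open>G(t)\<close> of the \<open>1 + t B\<^sub>k\<close> the product moves in the order \<open>t\<^sup>3\<close> only, by
  \<open>\<Sum> X\<^sub>k + \<Sum> (Y\<^sub>k B\<^sub>k - B\<^sub>k Y\<^sub>k\<^sub>+\<^sub>1)\<close> (\<open>product_expansion\<close>). For suitable \<open>B\<^sub>k\<close> every matrix
  arises in this way (\<open>tangent_surjective\<close>). So if a polynomial vanishes on all products, then
  its value at \<open>G(t) + t\<^sup>3 W\<close>, expanded in powers of \<open>t\<close>, has a coefficient of lowest order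
  that vanishes for all \<open>W\<close>; hence there is no such coefficient and the polynomial is zero.
\<close>

section \<open>Polynomial functions and families of polynomials\<close>

text \<open>
  Polynomial functions in variables indexed by an arbitrary type. The index type may be
  infinite although each function involves finitely many variables; so the spaces of
  \<open>n\<close> by \<open>n\<close> matrices, with \<open>n\<close> a number and not a type, all embed into one type of assignments.
\<close>

inductive polyfun :: "(('v \<Rightarrow> complex) \<Rightarrow> complex) \<Rightarrow> bool" where
  const: "polyfun (\<lambda>e. c)"
| var: "polyfun (\<lambda>e. e v)"
| add: "polyfun f \<Longrightarrow> polyfun g \<Longrightarrow> polyfun (\<lambda>e. f e + g e)"
| mult: "polyfun f \<Longrightarrow> polyfun g \<Longrightarrow> polyfun (\<lambda>e. f e * g e)"

lemma polyfun_diff: "polyfun f \<Longrightarrow> polyfun g \<Longrightarrow> polyfun (\<lambda>e. f e - g e)"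
  using polyfun.add[of f, OF _ polyfun.mult[OF polyfun.const[of "-1"], of g]] by simp

lemma polyfun_sum: "(\<And>i. i \<in> I \<Longrightarrow> polyfun (f i)) \<Longrightarrow> polyfun (\<lambda>e. \<Sum>i\<in>I. f i e)"
  by (induction I rule: infinite_finite_induct) (auto intro: polyfun.intros)

lemma polyfun_prod: "(\<And>i. i \<in> I \<Longrightarrow> polyfun (f i)) \<Longrightarrow> polyfun (\<lambda>e. \<Prod>i\<in>I. f i e)"
  by (induction I rule: infinite_finite_induct) (auto intro: polyfun.intros)

lemma polyfun_subst:
  assumes "polyfun f" "\<And>v. polyfun (\<lambda>e. g e v)"
  shows "polyfun (\<lambda>e. f (g e))"
  using assms(1) by induction (auto intro: polyfun.intros assms(2))

lemma polyfun_continuous: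
  assumes "polyfun f" "\<And>v. continuous_on UNIV (\<lambda>t::complex. e t v)"
  shows "continuous_on UNIV (\<lambda>t. f (e t))"
  using assms(1) by induction (auto intro!: continuous_intros assms(2))

text \<open>
  Polynomials in one distinguished variable, with coefficients polynomial in the others. The number
  \<open>N\<close> is a strict bound for the degree rather than the degree, because the degree depends on the
  assignment; the only family with \<open>N = 0\<close> is zero.
\<close>

definition poly_family :: "nat \<Rightarrow> (('v \<Rightarrow> complex) \<Rightarrow> complex poly) \<Rightarrow> bool" where
  "poly_family N P \<longleftrightarrow> (\<forall>j. polyfun (\<lambda>e. coeff (P e) j)) \<and> (\<forall>e. \<forall>j\<ge>N. coeff (P e) j = 0)"

lemma poly_familyD:
  assumes "poly_family N P"
  shows "polyfun (\<lambda>e. coeff (P e) j)" "j \<ge> N \<Longrightarrow> coeff (P e) j = 0"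
  using assms by (auto simp: poly_family_def)

lemma poly_family_add:
  assumes "poly_family N P" "poly_family M Q"
  shows "poly_family (max N M) (\<lambda>e. P e + Q e)"
  using assms by (auto simp: poly_family_def intro: polyfun.add)

lemma poly_family_diff:
  assumes "poly_family N P" "poly_family M Q"
  shows "poly_family (max N M) (\<lambda>e. P e - Q e)"
  using assms by (auto simp: poly_family_def intro: polyfun_diff)

lemma poly_family_mult:
  assumes "poly_family N P" "poly_family M Q"
  shows "poly_family (N + M) (\<lambda>e. P e * Q e)"
  unfolding poly_family_def
proof (intro conjI allI impI)
  fix j show "polyfun (\<lambda>e. coeff (P e * Q e) j)"
    unfolding coeff_mult using assms by (intro polyfun_sum polyfun.mult) (auto dest: poly_familyD)
next
  fix e j assume j: "N + M \<le> j"
  have "coeff (P e) i * coeff (Q e) (j - i) = 0" for i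
    using poly_familyD(2)[OF assms(1), of i e] poly_familyD(2)[OF assms(2), of "j - i" e] j
    by (cases "i \<ge> N") auto
  then show "coeff (P e * Q e) j = 0" unfolding coeff_mult by (intro sum.neutral ballI)
qed

lemma poly_family_monom: "polyfun f \<Longrightarrow> poly_family (Suc k) (\<lambda>e. monom (f e) k)"
  unfolding poly_family_def coeff_monom
  by (intro conjI allI impI, rename_tac j, case_tac "k = j") (auto intro: polyfun.const)

lemma poly_family_const: "polyfun f \<Longrightarrow> poly_family 1 (\<lambda>e. [:f e:])"
  using poly_family_monom[of f 0] by (simp add: monom_0)

lemma poly_family_fixed: "\<exists>N. poly_family N (\<lambda>e. p)"
  by (rule exI[of _ "Suc (degree p)"]) (auto simp: poly_family_def coeff_eq_0 intro: polyfun.const)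

lemma poly_family_power:
  assumes "poly_family N P" shows "\<exists>M. poly_family M (\<lambda>e. P e ^ k)"
proof (induction k)
  case 0 show ?case using poly_family_fixed[of 1] by simp
next
  case (Suc k) then show ?case using poly_family_mult[OF assms] by auto
qed

text \<open>
  Substituting polynomials in \<open>t\<close> for the variables. It serves to restrict a polynomial function
  to a line, to single out one variable, and to expand along a polynomial curve.
\<close>

lemma polyfun_subst_poly:
  assumes "polyfun f" and G: "\<And>v. \<exists>N. poly_family N (G v)"
  shows "\<exists>N P. poly_family N P \<and> (\<forall>w t. f (\<lambda>v. poly (G v w) t) = poly (P w) t)"
  using assms(1)
proof induction
  case (const c)
  show ?case using poly_family_const[OF polyfun.const] by (intro exI[of _ 1] exI[of _ "\<lambda>w. [:c:]"]) auto
next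
  case (var v)
  then show ?case using G[of v] by blast
next
  case (add f g)
  then obtain N P M Q where "poly_family N P" "poly_family M Q"
    "\<forall>w t. f (\<lambda>v. poly (G v w) t) = poly (P w) t" "\<forall>w t. g (\<lambda>v. poly (G v w) t) = poly (Q w) t" by blast
  then show ?case using poly_family_add[of N P M Q]
    by (intro exI[of _ "max N M"] exI[of _ "\<lambda>w. P w + Q w"]) auto
next
  case (mult f g)
  then obtain N P M Q where "poly_family N P" "poly_family M Q"
    "\<forall>w t. f (\<lambda>v. poly (G v w) t) = poly (P w) t" "\<forall>w t. g (\<lambda>v. poly (G v w) t) = poly (Q w) t" by blast
  then show ?case using poly_family_mult[of N P M Q]
    by (intro exI[of _ "N + M"] exI[of _ "\<lambda>w. P w * Q w"]) auto
qed

text \<open>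
  The ring of polynomial functions has no zero divisors: on the line through \<open>a\<close> and \<open>b\<close> both
  functions are nonzero polynomials in one variable.
\<close>

lemma polyfun_mult_nonzero:
  assumes f: "polyfun f" and g: "polyfun g" and "f a \<noteq> 0" "g b \<noteq> 0"
  shows "\<exists>e. f e * g e \<noteq> 0"
proof -
  define G where "G = (\<lambda>v (w :: 'a \<Rightarrow> complex). [:a v, b v - a v:])"
  have G: "\<exists>N. poly_family N (G v)" for v unfolding G_def by (rule poly_family_fixed)
  obtain P where P: "\<forall>w t. f (\<lambda>v. poly (G v w) t) = poly (P w) t"
    using polyfun_subst_poly[of f G, OF f G] by blast
  obtain Q where Q: "\<forall>w t. g (\<lambda>v. poly (G v w) t) = poly (Q w) t"
    using polyfun_subst_poly[of g G, OF g G] by blast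
  have "poly (P a) 0 \<noteq> 0" "poly (Q a) 1 \<noteq> 0"
    using assms P[THEN spec, THEN spec, of a 0] Q[THEN spec, THEN spec, of a 1] by (auto simp: G_def)
  then have "P a * Q a \<noteq> 0" by auto
  then obtain t where "poly (P a * Q a) t \<noteq> 0" using poly_all_0_iff_0 by blast
  then show ?thesis using P Q by (intro exI[of _ "\<lambda>v. poly (G v a) t"]) auto
qed

section \<open>Constructible sets and elimination of a quantifier\<close>

text \<open>
  The usual constructible sets; closure under complements follows from De Morgan's laws. The
  elimination below yields unions and intersections directly, also for non-divisibility.
\<close>

inductive_set constructible :: "('v \<Rightarrow> complex) set set" where
  zero: "polyfun f \<Longrightarrow> {e. f e = 0} \<in> constructible"
| nonzero: "polyfun f \<Longrightarrow> {e. f e \<noteq> 0} \<in> constructible"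
| Int: "S \<in> constructible \<Longrightarrow> T \<in> constructible \<Longrightarrow> S \<inter> T \<in> constructible"
| Un: "S \<in> constructible \<Longrightarrow> T \<in> constructible \<Longrightarrow> S \<union> T \<in> constructible"

lemma constructible_empty: "{} \<in> constructible"
  using constructible.zero[OF polyfun.const[of 1]] by simp

lemma constructible_UNIV: "UNIV \<in> constructible"
  using constructible.zero[OF polyfun.const[of 0]] by simp

lemma constructible_UN:
  "finite I \<Longrightarrow> (\<And>i. i \<in> I \<Longrightarrow> S i \<in> constructible) \<Longrightarrow> (\<Union>i\<in>I. S i) \<in> constructible"
  by (induction I rule: finite_induct) (auto intro: constructible.intros constructible_empty)

lemma constructible_INT:
  "finite I \<Longrightarrow> (\<And>i. i \<in> I \<Longrightarrow> S i \<in> constructible) \<Longrightarrow> (\<Inter>i\<in>I. S i) \<in> constructible"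
  by (induction I rule: finite_induct) (auto intro: constructible.intros constructible_UNIV)

text \<open>
  The property to contain or to miss a set \<open>{e. g e \<noteq> 0}\<close> with \<open>g\<close> nonzero is inherited by
  intersections and unions, because the product of two nonzero polynomial functions is nonzero.
\<close>

lemma constructible_dichotomy:
  assumes "S \<in> constructible"
  shows "\<exists>g. polyfun g \<and> (\<exists>e. g e \<noteq> 0) \<and> ({e. g e \<noteq> 0} \<subseteq> S \<or> {e. g e \<noteq> 0} \<inter> S = {})"
  using assms
proof induction
  case (zero f)
  show ?case
  proof (cases "\<exists>e. f e \<noteq> 0")
    case True
    then show ?thesis using zero by blast
  next
    case False
    then show ?thesis by (intro exI[of _ "\<lambda>e. 1"]) (auto intro: polyfun.const)
  qed
next
  case (nonzero f)
  show ?case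
  proof (cases "\<exists>e. f e \<noteq> 0")
    case True
    then show ?thesis using nonzero by blast
  next
    case False
    then show ?thesis by (intro exI[of _ "\<lambda>e. 1"]) (auto intro: polyfun.const)
  qed
next
  case (Int S T)
  then obtain g h where gh: "polyfun g" "\<exists>e. g e \<noteq> 0" "{e. g e \<noteq> 0} \<subseteq> S \<or> {e. g e \<noteq> 0} \<inter> S = {}"
    "polyfun h" "\<exists>e. h e \<noteq> 0" "{e. h e \<noteq> 0} \<subseteq> T \<or> {e. h e \<noteq> 0} \<inter> T = {}" by blast
  then show ?case using polyfun_mult_nonzero[of g h]
    by (intro exI[of _ "\<lambda>e. g e * h e"]) (auto intro: polyfun.mult)
next
  case (Un S T)
  then obtain g h where gh: "polyfun g" "\<exists>e. g e \<noteq> 0" "{e. g e \<noteq> 0} \<subseteq> S \<or> {e. g e \<noteq> 0} \<inter> S = {}"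
    "polyfun h" "\<exists>e. h e \<noteq> 0" "{e. h e \<noteq> 0} \<subseteq> T \<or> {e. h e \<noteq> 0} \<inter> T = {}" by blast
  then show ?case using polyfun_mult_nonzero[of g h]
    by (intro exI[of _ "\<lambda>e. g e * h e"]) (auto intro: polyfun.mult)
qed

text \<open>
  One step of pseudo-division of \<open>R\<close> by \<open>P\<close>: with formal leading coefficients \<open>c\<close> of \<open>P\<close> and \<open>d\<close> of
  \<open>R\<close> it is \<open>c R - d x\<^sup>M\<^sup>-\<^sup>N P\<close>. It avoids division by \<open>c\<close>, which is not polynomial, and is as good
  as the remainder wherever \<open>c \<noteq> 0\<close>.
\<close>

definition reduce_family where
  "reduce_family N P M R =
     (\<lambda>e. monom (coeff (P e) (N - 1)) 0 * R e - monom (coeff (R e) (M - 1)) (M - N) * (P e :: complex poly))"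

lemma poly_family_reduce:
  assumes P: "poly_family N P" and R: "poly_family M R" and "0 < N" "N \<le> M"
  shows "poly_family (M - 1) (reduce_family N P M R)"
  unfolding poly_family_def
proof (intro conjI allI impI)
  have "poly_family (max (Suc 0 + M) (Suc (M - N) + N)) (reduce_family N P M R)"
    unfolding reduce_family_def
    by (intro poly_family_diff poly_family_mult poly_family_monom P R poly_familyD(1)[OF P] poly_familyD(1)[OF R])
  then show "polyfun (\<lambda>e. coeff (reduce_family N P M R e) j)" for j by (rule poly_familyD)
  fix e j assume j: "M - 1 \<le> j"
  consider "j = M - 1" | "j \<ge> M" using j by linarith
  then show "coeff (reduce_family N P M R e) j = 0"
  proof cases
    case 1
    then show ?thesis using assms by (simp add: reduce_family_def coeff_monom_mult)
  next
    case 2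
    then show ?thesis using assms poly_familyD(2)[OF P, of "j - (M - N)" e] poly_familyD(2)[OF R, of j e]
      by (simp add: reduce_family_def coeff_monom_mult)
  qed
qed

text \<open>
  Where the leading coefficient of \<open>P\<close> does not vanish, pseudo-division replaces \<open>R\<close> by families
  of smaller and smaller degree without changing divisibility by \<open>P\<close>. Once the degree is below that of \<open>P\<close>,
  divisibility means that all coefficients vanish.
\<close>

lemma constructible_not_dvd:
  assumes P: "poly_family N P" and N: "0 < N"
  shows "poly_family M R \<Longrightarrow> \<exists>S \<in> constructible. \<forall>e. coeff (P e) (N - 1) \<noteq> 0 \<longrightarrow> (e \<in> S \<longleftrightarrow> \<not> P e dvd R e)"
proof (induction M arbitrary: R rule: less_induct)
  case (less M)
  show ?case
  proof (cases "N \<le> M")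
    case True
    obtain S where S: "S \<in> constructible"
      "\<forall>e. coeff (P e) (N - 1) \<noteq> 0 \<longrightarrow> (e \<in> S \<longleftrightarrow> \<not> P e dvd reduce_family N P M R e)"
      using less.IH[OF _ poly_family_reduce[OF P less.prems N True]] N True by auto
    have "P e dvd reduce_family N P M R e \<longleftrightarrow> P e dvd R e" if c: "coeff (P e) (N - 1) \<noteq> 0" for e
    proof -
      have "P e dvd reduce_family N P M R e \<longleftrightarrow> P e dvd smult (coeff (P e) (N - 1)) (R e)"
        unfolding reduce_family_def by (simp add: monom_0 dvd_diff_left_iff)
      also have "\<dots> \<longleftrightarrow> P e dvd R e" using c by (rule dvd_smult_iff)
      finally show ?thesis .
    qed
    then show ?thesis using S by (intro bexI[of _ S]) auto
  next
    case False
    have "P e dvd R e \<longleftrightarrow> (\<forall>j<M. coeff (R e) j = 0)" if c: "coeff (P e) (N - 1) \<noteq> 0" for e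
    proof -
      have "R e = 0" if "P e dvd R e"
      proof (rule ccontr)
        assume nz: "R e \<noteq> 0"
        have "N - 1 \<le> degree (P e)" using c by (rule le_degree)
        also have "\<dots> \<le> degree (R e)" using that nz by (rule dvd_imp_degree_le)
        finally have "M \<le> degree (R e)" using False by simp
        then have "coeff (R e) (degree (R e)) = 0" by (rule poly_familyD(2)[OF less.prems])
        then show False using nz by simp
      qed
      moreover have "R e = 0 \<longleftrightarrow> (\<forall>j<M. coeff (R e) j = 0)"
        using poly_familyD(2)[OF less.prems, of _ e] by (auto simp: poly_eq_iff) (meson not_le)
      ultimately show ?thesis by (metis dvd_0_right)
    qed
    then show ?thesis
      by (intro bexI[of _ "\<Union>j\<in>{..<M}. {e. coeff (R e) j \<noteq> 0}"] constructible_UN constructible.nonzero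
          poly_familyD(1)[OF less.prems]) auto
  qed
qed

text \<open>
  Elimination of \<open>x\<close> from a system of equations and one inequation, by induction on the sum of the
  formal degrees. Of two equations let \<open>P\<close> be the one of smaller degree, and split according to
  the vanishing of its leading coefficient: where it vanishes, \<open>P\<close> can be truncated; where it does
  not, the other equation can be reduced modulo \<open>P\<close>. What remains is at most one equation \<open>P\<close>, and by the
  fundamental theorem of algebra every root of \<open>P\<close> is a root of \<open>Q\<close> iff \<open>P\<close> divides the power of \<open>Q\<close>
  with exponent the degree of \<open>P\<close>.
\<close>

lemma constructible_ex_root_nonroot:
  assumes Q: "poly_family K Q"
  shows "\<forall>(N, P) \<in> set Ps. poly_family N P \<Longrightarrow>
    {e. \<exists>x. (\<forall>(N, P) \<in> set Ps. poly (P e) x = 0) \<and> poly (Q e) x \<noteq> 0} \<in> constructible"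
    (is "_ \<Longrightarrow> ?elim Ps \<in> _")
proof (induction "sum_list (map (Suc \<circ> fst) Ps)" arbitrary: Ps rule: less_induct)
  case less
  note fam = less.prems
  \<comment> \<open>In the measure each equation weighs \<open>Suc N\<close>, so that dropping the equation \<open>0 = 0\<close> is progress.\<close>
  have drop: "?elim Ps \<in> constructible" if Ps: "Ps = (N, P) # Rs" "N = 0" for N P Rs
  proof -
    have "P e = 0" for e using fam Ps poly_familyD(2)[of 0 P _ e] by (auto simp: poly_eq_iff)
    then have "?elim Ps = ?elim Rs" by (auto simp: Ps)
    then show ?thesis using less.hyps[of Rs] fam Ps by auto
  qed
  have trunc: "{e. coeff (P e) (N - 1) = 0} \<inter> ?elim Ps \<in> constructible"
    if Ps: "set Ps = set ((N, P) # Rs)" "length Ps = Suc (length Rs)"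
      "sum_list (map (Suc \<circ> fst) Ps) = sum_list (map (Suc \<circ> fst) ((N, P) # Rs))" and N: "0 < N" for N P Rs
  proof -
    define P' where "P' = (\<lambda>e. P e - monom (coeff (P e) (N - 1)) (N - 1))"
    have P: "poly_family N P" using fam Ps by auto
    have "poly_family (max N (Suc (N - 1))) P'"
      unfolding P'_def by (intro poly_family_diff poly_family_monom P poly_familyD(1)[OF P])
    moreover have "coeff (P' e) (N - 1) = 0" for e by (simp add: P'_def)
    ultimately have P': "poly_family (N - 1) P'" unfolding poly_family_def using N
      by simp (metis Suc_leI Suc_pred le_neq_implies_less)
    have "?elim ((N - 1, P') # Rs) \<in> constructible"
      using less.hyps[of "(N - 1, P') # Rs"] P' fam Ps N by auto
    then have "{e. coeff (P e) (N - 1) = 0} \<inter> ?elim ((N - 1, P') # Rs) \<in> constructible"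
      by (intro constructible.Int constructible.zero poly_familyD(1)[OF P])
    moreover have "{e. coeff (P e) (N - 1) = 0} \<inter> ?elim ((N - 1, P') # Rs)
      = {e. coeff (P e) (N - 1) = 0} \<inter> ?elim Ps"
      unfolding Ps(1) by (auto simp: P'_def)
    ultimately show ?thesis by simp
  qed
  have pseudo: "?elim Ps \<in> constructible"
    if Ps: "set Ps = set ((N, P) # (M, R) # Rs)" "length Ps = Suc (Suc (length Rs))"
      "sum_list (map (Suc \<circ> fst) Ps) = sum_list (map (Suc \<circ> fst) ((N, P) # (M, R) # Rs))" and N: "0 < N" "N \<le> M"
    for N P M R Rs
  proof -
    have P: "poly_family N P" and R: "poly_family M R" using fam Ps by auto
    define R' where "R' = reduce_family N P M R"
    have "?elim ((N, P) # (M - 1, R') # Rs) \<in> constructible"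
      using less.hyps[of "(N, P) # (M - 1, R') # Rs"] poly_family_reduce[OF P R N] P fam Ps N
      unfolding R'_def[symmetric] by auto
    then have "{e. coeff (P e) (N - 1) \<noteq> 0} \<inter> ?elim ((N, P) # (M - 1, R') # Rs) \<in> constructible"
      by (intro constructible.Int constructible.nonzero poly_familyD(1)[OF P])
    moreover have "poly (R' e) x = 0 \<longleftrightarrow> poly (R e) x = 0"
      if "poly (P e) x = 0" "coeff (P e) (N - 1) \<noteq> 0" for e x
      using that by (simp add: R'_def reduce_family_def poly_monom)
    then have "{e. coeff (P e) (N - 1) \<noteq> 0} \<inter> ?elim ((N, P) # (M - 1, R') # Rs)
      = {e. coeff (P e) (N - 1) \<noteq> 0} \<inter> ?elim Ps"
      unfolding Ps(1) by auto
    ultimately have "{e. coeff (P e) (N - 1) \<noteq> 0} \<inter> ?elim Ps \<in> constructible" by simp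
    moreover have "{e. coeff (P e) (N - 1) = 0} \<inter> ?elim Ps \<in> constructible"
      using trunc[of N P "(M, R) # Rs"] Ps N by simp
    ultimately have "({e. coeff (P e) (N - 1) \<noteq> 0} \<inter> ?elim Ps) \<union> ({e. coeff (P e) (N - 1) = 0} \<inter> ?elim Ps)
      \<in> constructible" by (rule constructible.Un)
    moreover have "({e. coeff (P e) (N - 1) \<noteq> 0} \<inter> ?elim Ps) \<union> ({e. coeff (P e) (N - 1) = 0} \<inter> ?elim Ps)
      = ?elim Ps" by blast
    ultimately show ?thesis by metis
  qed
  consider "Ps = []" | N P where "Ps = [(N, P)]" | N P M R Rs where "Ps = (N, P) # (M, R) # Rs"
    by (metis list.exhaust surj_pair)
  then show ?case
  proof cases
    case 1
    have "?elim Ps = (\<Union>j\<in>{..<K}. {e. coeff (Q e) j \<noteq> 0})"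
    proof -
      have "(\<exists>x. poly (Q e) x \<noteq> 0) \<longleftrightarrow> (\<exists>j<K. coeff (Q e) j \<noteq> 0)" for e
        using poly_all_0_iff_0[of "Q e"] poly_familyD(2)[OF Q, of _ e]
        by (auto simp: poly_eq_iff) (meson not_le)
      then show ?thesis using 1 by auto
    qed
    then show ?thesis
      using constructible_UN[of "{..<K}" "\<lambda>j. {e. coeff (Q e) j \<noteq> 0}"]
        constructible.nonzero[OF poly_familyD(1)[OF Q]] by simp
  next
    case 2
    have P: "poly_family N P" using fam 2 by auto
    show ?thesis
    proof (cases "N = 0")
      case True
      then show ?thesis using drop[of N P "[]"] 2 by simp
    next
      case False
      obtain M where M: "poly_family M (\<lambda>e. Q e ^ (N - 1))" using poly_family_power[OF Q] by blast
      obtain S where S: "S \<in> constructible"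
        "\<forall>e. coeff (P e) (N - 1) \<noteq> 0 \<longrightarrow> (e \<in> S \<longleftrightarrow> \<not> P e dvd Q e ^ (N - 1))"
        using constructible_not_dvd[OF P _ M] False by auto
      have "e \<in> S \<longleftrightarrow> e \<in> ?elim Ps" if c: "coeff (P e) (N - 1) \<noteq> 0" for e
      proof -
        have "degree (P e) \<le> N - 1"
          using poly_familyD(2)[OF P, of _ e] False by (intro degree_le) auto
        then have "degree (P e) = N - 1" using c le_degree by (metis le_antisym)
        moreover have "P e \<noteq> 0" using c by auto
        ultimately show ?thesis
          using nullstellensatz_univariate[of "P e" "Q e"] S c 2 by auto
      qed
      then have "?elim Ps = ({e. coeff (P e) (N - 1) \<noteq> 0} \<inter> S) \<union> ({e. coeff (P e) (N - 1) = 0} \<inter> ?elim Ps)"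
        by blast
      moreover have "\<dots> \<in> constructible"
        using trunc[of N P "[]"] 2 False S
        by (intro constructible.Un constructible.Int[OF constructible.nonzero] poly_familyD(1)[OF P]) auto
      ultimately show ?thesis by metis
    qed
  next
    case 3
    consider "N = 0" | "M = 0" | "0 < N" "N \<le> M" | "0 < M" "M \<le> N" by linarith
    then show ?thesis
    proof cases
      case 1 then show ?thesis using drop 3 by blast
    next
      case 2
      have "R e = 0" for e using fam 2 3 poly_familyD(2)[of 0 R _ e] by (auto simp: poly_eq_iff)
      then have "?elim Ps = ?elim ((N, P) # Rs)" by (auto simp: 3)
      then show ?thesis using less.hyps[of "(N, P) # Rs"] fam 3 by auto
    next
      case le: 3
      then show ?thesis using pseudo[of N P M R Rs] \<open>Ps = _\<close> by simp
    next
      case 4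
      then show ?thesis using pseudo[of M R N P Rs] 3 by (simp add: insert_commute)
    qed
  qed
qed

text \<open>
  Quantifier elimination applies to a conjunction of equations with a single inequation, and an
  existential quantifier commutes with unions. So constructible sets are first brought into
  disjunctive normal form; several inequations are merged by multiplication.
\<close>

definition basic_set :: "(('v \<Rightarrow> complex) \<Rightarrow> complex) list \<times> (('v \<Rightarrow> complex) \<Rightarrow> complex) \<Rightarrow> ('v \<Rightarrow> complex) set" where
  "basic_set c = {e. (\<forall>p \<in> set (fst c). p e = 0) \<and> snd c e \<noteq> 0}"

lemma constructible_normal_form:
  assumes "S \<in> constructible"
  shows "\<exists>C. finite C \<and> (\<forall>c \<in> C. (\<forall>p \<in> set (fst c). polyfun p) \<and> polyfun (snd c)) \<and>
    S = (\<Union>c \<in> C. basic_set c)"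
  using assms
proof induction
  case (zero f)
  then show ?case by (intro exI[of _ "{([f], \<lambda>e. 1)}"]) (auto simp: basic_set_def intro: polyfun.const)
next
  case (nonzero f)
  then show ?case by (intro exI[of _ "{([], f)}"]) (auto simp: basic_set_def)
next
  case (Int S T)
  then obtain C D where C: "finite C" "\<forall>c \<in> C. (\<forall>p \<in> set (fst c). polyfun p) \<and> polyfun (snd c)"
      "S = (\<Union>c \<in> C. basic_set c)"
    and D: "finite D" "\<forall>c \<in> D. (\<forall>p \<in> set (fst c). polyfun p) \<and> polyfun (snd c)"
      "T = (\<Union>c \<in> D. basic_set c)" by blast
  have meet: "basic_set c \<inter> basic_set d = basic_set (fst c @ fst d, \<lambda>e. snd c e * snd d e)"
    for c d :: "(('a \<Rightarrow> complex) \<Rightarrow> complex) list \<times> (('a \<Rightarrow> complex) \<Rightarrow> complex)"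
    by (auto simp: basic_set_def)
  have "S \<inter> T = (\<Union>x \<in> C \<times> D. basic_set (fst x) \<inter> basic_set (snd x))"
    unfolding C(3) D(3) by fastforce
  also have "\<dots> = (\<Union>c \<in> (\<lambda>x. (fst (fst x) @ fst (snd x), \<lambda>e. snd (fst x) e * snd (snd x) e)) ` (C \<times> D). basic_set c)"
    by (simp add: meet)
  finally show ?case using C(1,2) D(1,2)
    by (intro exI[of _ "(\<lambda>x. (fst (fst x) @ fst (snd x), \<lambda>e. snd (fst x) e * snd (snd x) e)) ` (C \<times> D)"])
      (auto intro: polyfun.mult)
next
  case (Un S T)
  then obtain C D where "finite C" "\<forall>c \<in> C. (\<forall>p \<in> set (fst c). polyfun p) \<and> polyfun (snd c)"
      "S = (\<Union>c \<in> C. basic_set c)"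
    and "finite D" "\<forall>c \<in> D. (\<forall>p \<in> set (fst c). polyfun p) \<and> polyfun (snd c)"
      "T = (\<Union>c \<in> D. basic_set c)" by blast
  then show ?case by (intro exI[of _ "C \<union> D"]) auto
qed

lemma constructible_projection:
  assumes "S \<in> constructible"
  shows "{e. \<exists>x. e(i := x) \<in> S} \<in> constructible"
proof -
  define G where "G = (\<lambda>v e. if v = i then [:0, 1:] else [:e v :: complex:])"
  have G: "\<exists>N. poly_family N (G v)" for v
  proof (cases "v = i")
    case True
    then show ?thesis using poly_family_fixed[of "[:0, 1:]"] by (simp add: G_def)
  next
    case False
    then show ?thesis using poly_family_const[OF polyfun.var[of v]] by (auto simp: G_def)
  qed
  have upd: "(\<lambda>v. poly (G v e) x) = e(i := x)" for e x by (auto simp: G_def)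
  have fam: "\<exists>N P. poly_family N P \<and> (\<forall>e x. f (e(i := x)) = poly (P e) x)" if "polyfun f" for f
    using polyfun_subst_poly[of f G, OF that G] unfolding upd by blast
  have basic: "{e. \<exists>x. (\<forall>p \<in> set ps. p (e(i := x)) = 0) \<and> q (e(i := x)) \<noteq> 0} \<in> constructible"
    if ps: "\<forall>p \<in> set ps. polyfun p" and q: "polyfun q" for ps q
  proof -
    have "\<forall>p\<in>set ps. \<exists>NP. poly_family (fst NP) (snd NP) \<and> (\<forall>e x. p (e(i := x)) = poly (snd NP e) x)"
      using fam ps by auto
    then obtain F where F: "\<forall>p\<in>set ps. poly_family (fst (F p)) (snd (F p)) \<and> (\<forall>e x. p (e(i := x)) = poly (snd (F p) e) x)"
      by metis
    obtain K Q where Q: "poly_family K Q" "\<forall>e x. q (e(i := x)) = poly (Q e) x" using fam[OF q] by blast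
    have "{e. \<exists>x. (\<forall>(N, P) \<in> set (map F ps). poly (P e) x = 0) \<and> poly (Q e) x \<noteq> 0} \<in> constructible"
      using F by (intro constructible_ex_root_nonroot[OF Q(1)]) (auto simp: split_beta)
    moreover have "{e. \<exists>x. (\<forall>(N, P) \<in> set (map F ps). poly (P e) x = 0) \<and> poly (Q e) x \<noteq> 0} =
      {e. \<exists>x. (\<forall>p \<in> set ps. p (e(i := x)) = 0) \<and> q (e(i := x)) \<noteq> 0}"
      using F Q by (auto simp: split_beta)
    ultimately show ?thesis by simp
  qed
  obtain C where C: "finite C" "\<forall>c \<in> C. (\<forall>p \<in> set (fst c). polyfun p) \<and> polyfun (snd c)"
      "S = (\<Union>c \<in> C. basic_set c)"
    using constructible_normal_form[OF assms] by blast
  have "{e. \<exists>x. e(i := x) \<in> S} =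
    (\<Union>c \<in> C. {e. \<exists>x. (\<forall>p \<in> set (fst c). p (e(i := x)) = 0) \<and> snd c (e(i := x)) \<noteq> 0})"
    unfolding C(3) by (auto simp: basic_set_def)
  also have "\<dots> \<in> constructible"
    using C by (intro constructible_UN basic) auto
  finally show ?thesis .
qed

lemma constructible_projection_finite:
  assumes "finite I" "S \<in> constructible"
  shows "{e. \<exists>x. (\<lambda>v. if v \<in> I then x v else e v) \<in> S} \<in> constructible"
  using assms(1)
proof (induction I rule: finite_induct)
  case empty
  then show ?case using assms(2) by simp
next
  case (insert i I)
  have "{e. \<exists>x. (\<lambda>v. if v \<in> insert i I then x v else e v) \<in> S} =
    {e. \<exists>y. e(i := y) \<in> {e. \<exists>x. (\<lambda>v. if v \<in> I then x v else e v) \<in> S}}" (is "?A = ?B")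
  proof
    show "?A \<subseteq> ?B"
    proof
      fix e assume "e \<in> ?A"
      then obtain x where x: "(\<lambda>v. if v \<in> insert i I then x v else e v) \<in> S" by blast
      have "(\<lambda>v. if v \<in> insert i I then x v else e v) = (\<lambda>v. if v \<in> I then x v else (e(i := x i)) v)" by auto
      then show "e \<in> ?B" using x by auto
    qed
    show "?B \<subseteq> ?A"
    proof
      fix e assume "e \<in> ?B"
      then obtain y x where x: "(\<lambda>v. if v \<in> I then x v else (e(i := y)) v) \<in> S" by blast
      have "(\<lambda>v. if v \<in> I then x v else (e(i := y)) v) = (\<lambda>v. if v \<in> insert i I then (x(i := y)) v else e v)"
        using insert.hyps by auto
      then show "e \<in> ?A" using x by auto
    qed
  qed
  then show ?case using constructible_projection[OF insert.IH, of i] by simp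
qed

section \<open>Toeplitz matrices and the displacement of a product\<close>

definition toep :: "nat \<Rightarrow> (int \<Rightarrow> 'a) \<Rightarrow> 'a mat" where
  "toep n f = mat n n (\<lambda>(i, j). f (int j - int i))"

lemma toep_carrier [simp]: "toep n f \<in> carrier_mat n n"
  by (simp add: toep_def)

lemma toep_dim [simp]: "dim_row (toep n f) = n" "dim_col (toep n f) = n"
  by (simp_all add: toep_def)

lemma toep_index [simp]: "i < n \<Longrightarrow> j < n \<Longrightarrow> toep n f $$ (i, j) = f (int j - int i)"
  by (simp add: toep_def)

lemma toeplitz_mat_toep: "toeplitz_mat (toep n f)"
  unfolding toeplitz_mat_def by auto

lemma eq_carrier_matI:
  "A \<in> carrier_mat n n \<Longrightarrow> B \<in> carrier_mat n n \<Longrightarrow>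
    (\<And>i j. i < n \<Longrightarrow> j < n \<Longrightarrow> A $$ (i, j) = B $$ (i, j)) \<Longrightarrow> A = B"
  by (rule eq_matI) auto

lemma mat_mult_index:
  assumes "A \<in> carrier_mat n n" "B \<in> carrier_mat n n" "i < n" "j < n"
  shows "(A * B) $$ (i, j) = (\<Sum>k<n. A $$ (i, k) * B $$ (k, j))"
  using assms by (auto simp: scalar_prod_def atLeast0LessThan intro!: sum.cong)

text \<open>
  Moving one step down a diagonal shifts the index of summation in the entry of the product, so the
  difference telescopes to two boundary terms. For products of Toeplitz matrices, this difference
  is a matrix of rank at most two, which makes the expressions linear in one
  factor tractable.
\<close>

lemma toep_mult_displacement:
  fixes x y :: "int \<Rightarrow> complex"
  assumes "Suc p < n" "Suc j < n"
  shows "(toep n x * toep n y) $$ (Suc p, Suc j) - (toep n x * toep n y) $$ (p, j) =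
    x (- int (Suc p)) * y (int (Suc j)) - x (int n - int (Suc p)) * y (int (Suc j) - int n)"
proof -
  define g where "g k = x (int k - int (Suc p)) * y (int (Suc j) - int k)" for k
  have "(toep n x * toep n y) $$ (Suc p, Suc j) = (\<Sum>k<n. g k)"
    using assms by (subst mat_mult_index) (auto simp: g_def)
  moreover have "(toep n x * toep n y) $$ (p, j) = (\<Sum>k<n. g (Suc k))"
    using assms by (subst mat_mult_index) (auto simp: g_def intro!: sum.cong)
  ultimately have "(toep n x * toep n y) $$ (Suc p, Suc j) - (toep n x * toep n y) $$ (p, j) = g 0 - g n"
    using sum_lessThan_telescope'[of g n] by (simp add: sum_subtractf)
  then show ?thesis by (simp add: g_def)
qed

lemma eq_toep_if_displacement_zero:
  assumes "\<And>p j. Suc p < n \<Longrightarrow> Suc j < n \<Longrightarrow> h (Suc p) (Suc j) = h p j"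
  shows "\<exists>x. \<forall>i<n. \<forall>j<n. h i j = x (int j - int i)"
proof -
  have shift: "h i j = h (i - l) (j - l)" if "i < n" "j < n" "l \<le> i" "l \<le> j" for i j l
    using that
  proof (induction l)
    case (Suc l)
    have "h (Suc (i - Suc l)) (Suc (j - Suc l)) = h (i - Suc l) (j - Suc l)"
      using Suc.prems by (intro assms) auto
    then show ?case using Suc by (simp add: Suc_diff_Suc)
  qed simp
  have "h i j = h (nat (- (int j - int i))) (nat (int j - int i))" if "i < n" "j < n" for i j
  proof (cases "i \<le> j")
    case True
    then show ?thesis using shift[OF that, of i] by (simp add: nat_diff_distrib')
  next
    case False
    then show ?thesis using shift[OF that, of j] by (simp add: nat_diff_distrib')
  qed
  then show ?thesis by (intro exI[of _ "\<lambda>d. h (nat (- d)) (nat d)"]) blast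
qed

text \<open>
  The solution \<open>W\<close> of the linear system \<open>W q p + W (p + 2) q = K q p\<close> for \<open>0 < p, q < n\<close>, where
  \<open>W\<close> is zero as soon as an index reaches \<open>n\<close>. The recursion ends since the sum of the indices
  grows by two. The convention \<open>W 0 p = 0\<close> makes the symbol with index zero vanish in
  \<open>tangent_surjective\<close>.
\<close>

function back_subst :: "nat \<Rightarrow> (nat \<Rightarrow> nat \<Rightarrow> complex) \<Rightarrow> nat \<Rightarrow> nat \<Rightarrow> complex" where
  "back_subst n K a p =
     (if a = 0 \<or> n \<le> a \<or> n \<le> p then 0 else K a p - back_subst n K (p + 2) a)"
  by auto
termination by (relation "measure (\<lambda>(n, K, a, p). 2 * n - (a + p))") auto

declare back_subst.simps [simp del]

text \<open>
  The symbol of \<open>B\<^sub>k\<close>. It is chosen such that in the displacement of \<open>Y * B\<^sub>k\<close> the boundary terms of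
  \<open>B\<^sub>k\<close> are unit vectors or zero: its only nonzero entries lie on a superdiagonal and on a subdiagonal (or,
  for \<open>k = 0\<close>, on the main diagonal), and no diagonal is used for two values of \<open>k\<close>. Diagonals beyond the
  corner of the matrix disappear.
\<close>

definition base_symbol :: "nat \<Rightarrow> nat \<Rightarrow> int \<Rightarrow> complex" where
  "base_symbol n k d = (if d = int n + 1 - 2 * int k \<or> d = - 2 * int k then 1 else 0)"

text \<open>
  It suffices to match the displacements of both sides, since a matrix without displacement is
  Toeplitz and can be taken for \<open>x\<close>. Put \<open>q = n - j\<close> for the column \<open>j\<close>, and collect the boundary values of the \<open>y k\<close>
  in one array, \<open>W (2 k - 1) p = y\<^sub>k (- p)\<close> and \<open>W (2 k) p = - y\<^sub>k (n - p)\<close>. With the chosen \<open>B\<^sub>k\<close> the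
  displacement of the sum in row \<open>p\<close> and column \<open>j\<close> becomes \<open>W q p + W (p + 2) q\<close>, and the
  resulting system is solved by back substitution.
\<close>

lemma tangent_surjective:
  fixes M :: "complex mat"
  shows "\<exists>x y. y 0 = (\<lambda>d. 0) \<and> y (Suc (n div 2)) = (\<lambda>d. 0) \<and>
    (\<forall>i<n. \<forall>j<n. M $$ (i, j) = x (int j - int i) +
      (\<Sum>k\<le>n div 2. (toep n (y k) * toep n (base_symbol n k)) $$ (i, j) -
         (toep n (base_symbol n k) * toep n (y (Suc k))) $$ (i, j)))"
proof -
  define K where "K q p = M $$ (p, n - q) - M $$ (p - 1, n - q - 1)" for q p
  define W where "W = back_subst n K"
  have W0: "W a p = 0" if "a = 0 \<or> n \<le> a \<or> n \<le> p" for a p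
    using that unfolding W_def by (subst back_subst.simps) auto
  have W: "W q p + W (p + 2) q = K q p" if "0 < q" "q < n" "p < n" for p q
    using that unfolding W_def by (subst back_subst.simps) auto
  define y where "y k d = (if d < 0 then W (2 * k - 1) (nat (- d))
    else if d > 0 then - W (2 * k) (nat (int n - d)) else 0)" for k d
  define S where "S i j = (\<Sum>k\<le>n div 2. (toep n (y k) * toep n (base_symbol n k)) $$ (i, j) -
         (toep n (base_symbol n k) * toep n (y (Suc k))) $$ (i, j))" for i j
  have disp: "S (Suc p) (Suc j) - S p j = M $$ (Suc p, Suc j) - M $$ (p, j)"
    if pj: "Suc p < n" "Suc j < n" for p j
  proof -
    define q where "q = n - Suc j"
    define P where "P = Suc p"
    have q: "0 < q" "q < n" "int (Suc j) = int n - int q" using pj by (auto simp: q_def of_nat_diff)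
    have P: "0 < P" "P < n" using pj by (auto simp: P_def)
    have "S P (Suc j) - S p j = (\<Sum>k\<le>n div 2.
      (y k (- int P) * base_symbol n k (int n - int q) - y k (int n - int P) * base_symbol n k (- int q)) -
      (base_symbol n k (- int P) * y (Suc k) (int n - int q) - base_symbol n k (int n - int P) * y (Suc k) (- int q)))"
      unfolding S_def sum_subtractf[symmetric] P_def
      using toep_mult_displacement[OF pj] unfolding q(3)
      by (intro sum.cong refl) (simp add: algebra_simps)
    also have "\<dots> = (\<Sum>k\<le>n div 2. (if k = (q + 1) div 2 then W q P else 0) + (if k = (P + 1) div 2 then W (P + 2) q else 0))"
    proof (intro sum.cong refl)
      fix k assume k: "k \<in> {..n div 2}"
      have b1: "base_symbol n k (int n - int q) = (if q + 1 = 2 * k then 1 else 0)"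
        "base_symbol n k (int n - int P) = (if P + 1 = 2 * k then 1 else 0)"
        using q P by (auto simp: base_symbol_def)
      have b2: "base_symbol n k (- int q) = (if q = 2 * k then 1 else 0)"
        "base_symbol n k (- int P) = (if P = 2 * k then 1 else 0)"
        using q P k by (auto simp: base_symbol_def)
      have y: "y k (- int P) = W (2 * k - 1) P" "y k (int n - int P) = - W (2 * k) P"
        "y (Suc k) (int n - int q) = - W (2 * k + 2) q" "y (Suc k) (- int q) = W (2 * k + 1) q"
        using q P by (auto simp: y_def)
      consider l where "q = 2 * l" | l where "q + 1 = 2 * l" by (metis evenE odd_even_add odd_one)
      then have q': "(if q + 1 = 2 * k then W (2 * k - 1) P else 0) + (if q = 2 * k then W (2 * k) P else 0)
         = (if k = (q + 1) div 2 then W q P else 0)"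
        by cases (auto intro!: arg_cong2[of _ _ _ _ W])
      consider l where "P = 2 * l" | l where "P + 1 = 2 * l" by (metis evenE odd_even_add odd_one)
      then have P': "(if P = 2 * k then W (2 * k + 2) q else 0) + (if P + 1 = 2 * k then W (2 * k + 1) q else 0)
         = (if k = (P + 1) div 2 then W (P + 2) q else 0)"
        by cases (auto intro!: arg_cong2[of _ _ _ _ W])
      show "(y k (- int P) * base_symbol n k (int n - int q) - y k (int n - int P) * base_symbol n k (- int q)) -
        (base_symbol n k (- int P) * y (Suc k) (int n - int q) - base_symbol n k (int n - int P) * y (Suc k) (- int q))
        = (if k = (q + 1) div 2 then W q P else 0) + (if k = (P + 1) div 2 then W (P + 2) q else 0)"
        unfolding b1 b2 y q'[symmetric] P'[symmetric] by simp
    qed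
    also have "\<dots> = W q P + W (P + 2) q"
      using q P by (simp add: sum.distrib) linarith
    also have "\<dots> = K q P" using q P by (intro W)
    also have "\<dots> = M $$ (Suc p, Suc j) - M $$ (p, j)"
      using pj by (simp add: K_def q_def P_def)
    finally show ?thesis by (simp add: P_def)
  qed
  have "M $$ (Suc p, Suc j) - S (Suc p) (Suc j) = M $$ (p, j) - S p j" if "Suc p < n" "Suc j < n" for p j
    using disp[OF that] by (simp add: algebra_simps)
  then obtain x where x: "\<forall>i<n. \<forall>j<n. M $$ (i, j) - S i j = x (int j - int i)"
    using eq_toep_if_displacement_zero[of n "\<lambda>i j. M $$ (i, j) - S i j"] by blast
  \<comment> \<open>The last symbol vanishes because its values are \<open>W a p\<close> with \<open>a \<ge> n\<close>.\<close>
  have "n \<le> Suc (2 * (n div 2))" by linarith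
  then have "y 0 = (\<lambda>d. 0)" "y (Suc (n div 2)) = (\<lambda>d. 0)"
    using W0 W0[OF disjI2[OF disjI1]] by (auto simp: y_def fun_eq_iff)
  then show ?thesis using x by (intro exI[of _ x] exI[of _ y]) (auto simp: S_def[symmetric] algebra_simps simp del: index_mult_mat(1))
qed

section \<open>Expansion of a product of Toeplitz matrices near the identity\<close>

lemma mat_prod_list_carrier:
  "(\<And>A. A \<in> set As \<Longrightarrow> A \<in> carrier_mat n n) \<Longrightarrow> mat_prod_list n As \<in> carrier_mat n n"
  by (induction As) (auto simp: mat_prod_list_def intro!: mult_carrier_mat[of _ n n _ n])

lemma mat_prod_list_append:
  fixes As Bs :: "'a :: semiring_1 mat list"
  assumes "\<And>A. A \<in> set As \<Longrightarrow> A \<in> carrier_mat n n" "\<And>A. A \<in> set Bs \<Longrightarrow> A \<in> carrier_mat n n"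
  shows "mat_prod_list n (As @ Bs) = mat_prod_list n As * mat_prod_list n Bs"
  using assms(1)
proof (induction As)
  case Nil
  then show ?case using left_mult_one_mat[OF mat_prod_list_carrier, OF assms(2)] by (simp add: mat_prod_list_def)
next
  case (Cons A As)
  have "mat_prod_list n (A # As @ Bs) = A * (mat_prod_list n As * mat_prod_list n Bs)"
    using Cons by (simp add: mat_prod_list_def)
  also have "\<dots> = A * mat_prod_list n As * mat_prod_list n Bs"
    using Cons.prems assms(2) by (intro assoc_mult_mat[symmetric, of _ n n _ n _ n] mat_prod_list_carrier) auto
  finally show ?case by (simp add: mat_prod_list_def)
qed

lemma mat_prod_list_snoc:
  fixes F :: "nat \<Rightarrow> 'a :: semiring_1 mat"
  assumes "\<And>l. F l \<in> carrier_mat n n"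
  shows "mat_prod_list n (map F [0..<Suc k]) = mat_prod_list n (map F [0..<k]) * F k"
proof -
  have "mat_prod_list n [F k] = F k" using assms right_mult_one_mat by (auto simp: mat_prod_list_def)
  moreover have "mat_prod_list n (map F [0..<k] @ [F k]) = mat_prod_list n (map F [0..<k]) * mat_prod_list n [F k]"
    using assms by (intro mat_prod_list_append) auto
  ultimately show ?thesis by simp
qed

text \<open>
  Multiplying by the next factor carries \<open>1 + t\<^sup>2 Y\<close> through \<open>1 + t B\<close> and turns it into
  \<open>1 + t\<^sup>2 Z\<close>. The price is paid in order \<open>t\<^sup>3\<close>, where \<open>Y B - B Z\<close> appears.
\<close>

lemma perturbation_step:
  fixes B :: "complex mat"
  assumes c: "B \<in> carrier_mat n n" "Y \<in> carrier_mat n n" "Z \<in> carrier_mat n n" "X \<in> carrier_mat n n"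
  shows "(1\<^sub>m n + t^2 \<cdot>\<^sub>m Y) * (1\<^sub>m n + t \<cdot>\<^sub>m B + t^2 \<cdot>\<^sub>m (Z - Y) + t^3 \<cdot>\<^sub>m X) =
    (1\<^sub>m n + t \<cdot>\<^sub>m B) * (1\<^sub>m n + t^2 \<cdot>\<^sub>m Z) +
    t^3 \<cdot>\<^sub>m (X + Y * B - B * Z + t \<cdot>\<^sub>m (Y * (Z - Y)) + t^2 \<cdot>\<^sub>m (Y * X))"
    (is "?L = ?R")
proof -
  have e: "(1\<^sub>m n + t^2 \<cdot>\<^sub>m Y) * (1\<^sub>m n + t \<cdot>\<^sub>m B + t^2 \<cdot>\<^sub>m (Z - Y) + t^3 \<cdot>\<^sub>m X) =
    1\<^sub>m n + t^2 \<cdot>\<^sub>m Y + t \<cdot>\<^sub>m (B + t^2 \<cdot>\<^sub>m (Y * B)) +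
    t^2 \<cdot>\<^sub>m (Z - Y + t^2 \<cdot>\<^sub>m (Y * (Z - Y))) + t^3 \<cdot>\<^sub>m (X + t^2 \<cdot>\<^sub>m (Y * X))"
    using c by (simp add: add_mult_distrib_mat[of _ n n _ _ n] mult_add_distrib_mat[of _ n n _ n]
        mult_smult_distrib[of _ n n _ n] mult_smult_assoc_mat[of _ n n _ n] minus_carrier_mat)
  have e': "(1\<^sub>m n + t \<cdot>\<^sub>m B) * (1\<^sub>m n + t^2 \<cdot>\<^sub>m Z) = 1\<^sub>m n + t \<cdot>\<^sub>m B + t^2 \<cdot>\<^sub>m (Z + t \<cdot>\<^sub>m (B * Z))"
    using c by (simp add: add_mult_distrib_mat[of _ n n _ _ n] mult_add_distrib_mat[of _ n n _ n]
        mult_smult_distrib[of _ n n _ n] mult_smult_assoc_mat[of _ n n _ n] minus_carrier_mat)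
  have "?L \<in> carrier_mat n n" "?R \<in> carrier_mat n n"
    using c by (auto intro!: add_carrier_mat smult_carrier_mat mult_carrier_mat[of _ n n _ n] minus_carrier_mat)
  moreover have "?L $$ (i, j) = ?R $$ (i, j)" if "i < n" "j < n" for i j
    unfolding e e' using c that
    by (simp add: algebra_simps power2_eq_square power3_eq_cube del: index_mult_mat(1))
  ultimately show ?thesis by (rule eq_carrier_matI)
qed

definition polyfun_mat :: "nat \<Rightarrow> (('v \<Rightarrow> complex) \<Rightarrow> complex mat) \<Rightarrow> bool" where
  "polyfun_mat n F \<longleftrightarrow> (\<forall>e. F e \<in> carrier_mat n n) \<and> (\<forall>i<n. \<forall>j<n. polyfun (\<lambda>e. F e $$ (i, j)))"

lemma polyfun_mat_carrier: "polyfun_mat n F \<Longrightarrow> F e \<in> carrier_mat n n"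
  by (simp add: polyfun_mat_def)

lemma polyfun_mat_const: "A \<in> carrier_mat n n \<Longrightarrow> polyfun_mat n (\<lambda>e. A)"
  by (auto simp: polyfun_mat_def intro: polyfun.const)

lemma polyfun_mat_add:
  assumes "polyfun_mat n F" "polyfun_mat n G" shows "polyfun_mat n (\<lambda>e. F e + G e)"
  unfolding polyfun_mat_def
proof (intro conjI allI impI)
  fix i j assume ij: "i < n" "j < n"
  have "(\<lambda>e. (F e + G e) $$ (i, j)) = (\<lambda>e. F e $$ (i, j) + G e $$ (i, j))"
    using carrier_matD[OF polyfun_mat_carrier[OF assms(2)]] ij by (intro ext index_add_mat) auto
  then show "polyfun (\<lambda>e. (F e + G e) $$ (i, j))"
    using assms ij by (auto simp: polyfun_mat_def intro: polyfun.add)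
qed (use assms in \<open>auto simp: polyfun_mat_def\<close>)

lemma polyfun_mat_smult:
  assumes "polyfun f" "polyfun_mat n F" shows "polyfun_mat n (\<lambda>e. f e \<cdot>\<^sub>m F e)"
  unfolding polyfun_mat_def
proof (intro conjI allI impI)
  fix i j assume ij: "i < n" "j < n"
  have "(\<lambda>e. (f e \<cdot>\<^sub>m F e) $$ (i, j)) = (\<lambda>e. f e * F e $$ (i, j))"
    using carrier_matD[OF polyfun_mat_carrier[OF assms(2)]] ij by (intro ext index_smult_mat) auto
  then show "polyfun (\<lambda>e. (f e \<cdot>\<^sub>m F e) $$ (i, j))"
    using assms ij by (auto simp: polyfun_mat_def intro: polyfun.mult)
qed (use assms in \<open>auto simp: polyfun_mat_def\<close>)

lemma polyfun_mat_mult: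
  assumes "polyfun_mat n F" "polyfun_mat n G" shows "polyfun_mat n (\<lambda>e. F e * G e)"
  unfolding polyfun_mat_def
proof (intro conjI allI impI)
  fix i j assume ij: "i < n" "j < n"
  have "(\<lambda>e. (F e * G e) $$ (i, j)) = (\<lambda>e. \<Sum>k<n. F e $$ (i, k) * G e $$ (k, j))"
    using assms ij by (intro ext mat_mult_index) (auto intro: polyfun_mat_carrier)
  then show "polyfun (\<lambda>e. (F e * G e) $$ (i, j))"
    using assms ij by (auto simp: polyfun_mat_def intro!: polyfun_sum polyfun.mult)
qed (use polyfun_mat_carrier[OF assms(1)] polyfun_mat_carrier[OF assms(2)] in \<open>auto intro: mult_carrier_mat\<close>)

lemma polyfun_mat_prod_list:
  "(\<And>k. k \<in> set ks \<Longrightarrow> polyfun_mat n (F k)) \<Longrightarrow> polyfun_mat n (\<lambda>e. mat_prod_list n (map (\<lambda>k. F k e) ks))"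
  by (induction ks) (auto simp: mat_prod_list_def intro: polyfun_mat_const polyfun_mat_mult)

lemma polyfun_mat_toep:
  "(\<And>d. polyfun (\<lambda>e. f e d)) \<Longrightarrow> polyfun_mat n (\<lambda>e. toep n (f e))"
  by (simp add: polyfun_mat_def)

text \<open>
  The remainder \<open>E\<close> is polynomial in \<open>t\<close>, here the value at the only variable, indexed by \<open>()\<close>.
  The factor \<open>1 + t\<^sup>2 Y\<^sub>k\<close> is what the telescoping terms of order \<open>t\<^sup>2\<close> leave behind after
  \<open>k\<close> factors; it is \<open>1\<close> at the end of the product if the last \<open>Y\<close> is zero.
\<close>

lemma product_expansion:
  fixes B X Y :: "nat \<Rightarrow> complex mat"
  assumes c: "\<And>k. B k \<in> carrier_mat n n" "\<And>k. X k \<in> carrier_mat n n" "\<And>k. Y k \<in> carrier_mat n n"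
    and Y0: "Y 0 = 0\<^sub>m n n"
  defines "T \<equiv> \<lambda>t k. 1\<^sub>m n + t \<cdot>\<^sub>m B k + t^2 \<cdot>\<^sub>m (Y (Suc k) - Y k) + t^3 \<cdot>\<^sub>m X k"
    and "C \<equiv> \<lambda>t k. 1\<^sub>m n + t \<cdot>\<^sub>m B k"
  shows "\<exists>E. polyfun_mat n E \<and>
    (\<forall>e. mat_prod_list n (map (T (e ())) [0..<k]) =
       mat_prod_list n (map (C (e ())) [0..<k]) * (1\<^sub>m n + (e ())^2 \<cdot>\<^sub>m Y k) + (e ())^3 \<cdot>\<^sub>m E e) \<and>
    (\<forall>i<n. \<forall>j<n. E (\<lambda>u. 0) $$ (i, j) = (\<Sum>l<k. (X l + Y l * B l - B l * Y (Suc l)) $$ (i, j)))"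
proof (induction k)
  case 0
  show ?case using Y0
    by (intro exI[of _ "\<lambda>e. 0\<^sub>m n n"]) (auto intro: polyfun_mat_const simp: mat_prod_list_def)
next
  case (Suc k)
  then obtain E where E: "polyfun_mat n E"
    "\<And>e. mat_prod_list n (map (T (e ())) [0..<k]) =
       mat_prod_list n (map (C (e ())) [0..<k]) * (1\<^sub>m n + (e ())^2 \<cdot>\<^sub>m Y k) + (e ())^3 \<cdot>\<^sub>m E e"
    "\<And>i j. i < n \<Longrightarrow> j < n \<Longrightarrow> E (\<lambda>u. 0) $$ (i, j) = (\<Sum>l<k. (X l + Y l * B l - B l * Y (Suc l)) $$ (i, j))"
    by blast
  define P where "P = (\<lambda>t k. mat_prod_list n (map (T t) [0..<k]))"
  define G where "G = (\<lambda>t k. mat_prod_list n (map (C t) [0..<k]))"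
  define R where "R = (\<lambda>t. X k + Y k * B k - B k * Y (Suc k) + t \<cdot>\<^sub>m (Y k * (Y (Suc k) - Y k)) + t^2 \<cdot>\<^sub>m (Y k * X k))"
  have sub: "M - M' = M + (-1) \<cdot>\<^sub>m M'" if "M \<in> carrier_mat n n" "M' \<in> carrier_mat n n" for M M' :: "complex mat"
    using that by (intro eq_matI) auto
  have cT: "T t l \<in> carrier_mat n n" and cC: "C t l \<in> carrier_mat n n" for t l
    using c by (auto simp: T_def C_def)
  have cR: "R t \<in> carrier_mat n n" for t
    using c unfolding R_def by (auto intro!: add_carrier_mat smult_carrier_mat mult_carrier_mat[of _ n n _ n] minus_carrier_mat)
  have cG: "G t l \<in> carrier_mat n n" for t l
    unfolding G_def using cC by (intro mat_prod_list_carrier) auto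
  have cE: "E e \<in> carrier_mat n n" for e by (rule polyfun_mat_carrier[OF E(1)])
  have P_Suc: "P t (Suc k) = P t k * T t k" for t
    unfolding P_def using cT by (intro mat_prod_list_snoc)
  have G_Suc: "G t (Suc l) = G t l * C t l" for t l
    unfolding G_def using cC by (intro mat_prod_list_snoc)
  define E' where "E' = (\<lambda>e. G (e ()) k * R (e ()) + E e * T (e ()) k)"
  have step: "P (e ()) (Suc k) = G (e ()) (Suc k) * (1\<^sub>m n + (e ())^2 \<cdot>\<^sub>m Y (Suc k)) + (e ())^3 \<cdot>\<^sub>m E' e" for e
  proof -
    define t where "t = e ()"
    define Q where "Q = 1\<^sub>m n + t^2 \<cdot>\<^sub>m Y k"
    define Q' where "Q' = 1\<^sub>m n + t^2 \<cdot>\<^sub>m Y (Suc k)"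
    have cQ: "Q \<in> carrier_mat n n" "Q' \<in> carrier_mat n n" using c by (auto simp: Q_def Q'_def)
    have "P t (Suc k) = (G t k * Q + t^3 \<cdot>\<^sub>m E e) * T t k"
      using E(2)[of e] by (simp add: P_Suc t_def Q_def) (simp add: P_def G_def)
    also have "\<dots> = G t k * (Q * T t k) + t^3 \<cdot>\<^sub>m (E e * T t k)"
      using cT cG cE cQ by (simp add: add_mult_distrib_mat[of _ n n _ _ n] mult_smult_assoc_mat[of _ n n _ n]
          assoc_mult_mat[of _ n n _ n _ n] mult_carrier_mat[of _ n n _ n])
    also have "Q * T t k = C t k * Q' + t^3 \<cdot>\<^sub>m R t"
      unfolding Q_def Q'_def T_def C_def R_def using c by (intro perturbation_step)
    also have "G t k * (C t k * Q' + t^3 \<cdot>\<^sub>m R t) = G t k * C t k * Q' + t^3 \<cdot>\<^sub>m (G t k * R t)"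
      using cC cG cR cQ by (simp add: mult_add_distrib_mat[of _ n n _ n] mult_smult_distrib[of _ n n _ n]
          assoc_mult_mat[of _ n n _ n _ n] mult_carrier_mat[of _ n n _ n])
    also have "\<dots> + t^3 \<cdot>\<^sub>m (E e * T t k) = G t k * C t k * Q' + t^3 \<cdot>\<^sub>m (G t k * R t + E e * T t k)"
      using cC cG cR cQ cT cE
      by (simp add: add_smult_distrib_left_mat[of _ n n] mult_carrier_mat[of _ n n _ n] assoc_add_mat[of _ n n])
    finally show ?thesis by (simp add: t_def Q'_def E'_def G_Suc)
  qed
  have pt: "polyfun (\<lambda>e :: unit \<Rightarrow> complex. e () ^ l)" for l
    by (induction l) (auto intro: polyfun.intros)
  note pt1 = pt[of 1, unfolded power_one_right]
  have pT: "polyfun_mat n (\<lambda>e :: unit \<Rightarrow> complex. T (e ()) k)" unfolding T_def using c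
    by (intro polyfun_mat_add polyfun_mat_smult polyfun_mat_const pt pt1) (auto intro: minus_carrier_mat)
  have pC: "polyfun_mat n (\<lambda>e :: unit \<Rightarrow> complex. C (e ()) l)" for l unfolding C_def using c
    by (intro polyfun_mat_add polyfun_mat_smult polyfun_mat_const pt pt1) auto
  have pR: "polyfun_mat n (\<lambda>e :: unit \<Rightarrow> complex. R (e ()))" unfolding R_def using c
    by (intro polyfun_mat_add polyfun_mat_smult polyfun_mat_const pt pt1)
      (auto intro!: add_carrier_mat smult_carrier_mat mult_carrier_mat[of _ n n _ n] minus_carrier_mat)
  have pG: "polyfun_mat n (\<lambda>e :: unit \<Rightarrow> complex. G (e ()) k)" unfolding G_def
    by (intro polyfun_mat_prod_list pC)
  have pE': "polyfun_mat n E'" unfolding E'_def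
    by (intro polyfun_mat_add polyfun_mat_mult pG pR pT E(1))
  have T0: "T 0 l = 1\<^sub>m n" for l
    using c[THEN carrier_matD(1)] c[THEN carrier_matD(2)] unfolding T_def by (intro eq_matI) auto
  have C0: "C 0 l = 1\<^sub>m n" for l
    using c(1)[THEN carrier_matD(1)] c(1)[THEN carrier_matD(2)] unfolding C_def by (intro eq_matI) auto
  have "G 0 l = 1\<^sub>m n" for l
  proof (induction l)
    case 0
    show ?case by (simp add: G_def mat_prod_list_def)
  next
    case (Suc l)
    then show ?case by (simp add: G_Suc C0)
  qed
  then have E'0: "E' (\<lambda>u. 0) = R 0 + E (\<lambda>u. 0)"
    using cR cE by (simp add: E'_def T0 left_mult_one_mat[of _ n n] right_mult_one_mat[of _ n n])
  have R0: "R 0 $$ (i, j) = (X k + Y k * B k - B k * Y (Suc k)) $$ (i, j)" if "i < n" "j < n" for i j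
    using that c[THEN carrier_matD(1)] c[THEN carrier_matD(2)] unfolding R_def by (simp del: index_mult_mat(1))
  have "E' (\<lambda>u. 0) $$ (i, j) = (\<Sum>l<Suc k. (X l + Y l * B l - B l * Y (Suc l)) $$ (i, j))"
    if ij: "i < n" "j < n" for i j
    using cE[of "\<lambda>u. 0"] E(3)[OF ij] R0[OF ij] ij by (simp add: E'0 del: index_mult_mat(1) index_minus_mat(1))
  then show ?case using pE' step unfolding P_def G_def by blast
qed

section \<open>No nonzero polynomial vanishes on all products\<close>

text \<open>The point of the space of assignments at which polynomial functions of the matrix are evaluated.\<close>

definition entries :: "nat \<Rightarrow> complex mat \<Rightarrow> nat \<times> nat \<Rightarrow> complex" where
  "entries n A = (\<lambda>(i, j). if i < n \<and> j < n then A $$ (i, j) else 0)"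

lemma polyfun_entries: "polyfun_mat n F \<Longrightarrow> polyfun (\<lambda>e. entries n (F e) v)"
  by (cases v; cases "fst v < n \<and> snd v < n") (auto simp: entries_def polyfun_mat_def intro: polyfun.const)

text \<open>
  Expand \<open>q (G(t) + t\<^sup>3 W)\<close> in powers of \<open>t\<close>, with coefficients polynomial in \<open>W\<close>. If \<open>q\<close> is nonzero
  at some matrix, then some coefficient is not identically zero, since every matrix has the form
  \<open>G(1) + W\<close>. Let \<open>d\<close> be the least exponent of such a coefficient, and let it be nonzero at \<open>A\<close>. There
  are products of the form \<open>G(t) + t\<^sup>3 E(t)\<close> with \<open>E(0) = A\<close>; on them \<open>q\<close> vanishes. Dividing by
  \<open>t\<^sup>d\<close> and letting \<open>t\<close> tend to zero, the coefficient at \<open>A\<close> is zero, a contradiction.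
\<close>

lemma vanishes_on_products_imp_zero:
  assumes q: "polyfun q"
    and zero: "\<And>f. q (entries n (mat_prod_list n (map (\<lambda>k. toep n (f k)) [0..<n div 2 + 1]))) = 0"
    and M: "M \<in> carrier_mat n n"
  shows "q (entries n M) = 0"
proof (rule ccontr)
  assume nz: "q (entries n M) \<noteq> 0"
  define r where "r = n div 2 + 1"
  define B where "B k = toep n (base_symbol n k)" for k
  define C where "C t k = 1\<^sub>m n + t \<cdot>\<^sub>m B k" for t k
  define G where "G t = mat_prod_list n (map (C t) [0..<r])" for t
  have cC: "C t k \<in> carrier_mat n n" for t k by (simp add: C_def B_def)
  have cG: "G t \<in> carrier_mat n n" for t unfolding G_def using cC by (intro mat_prod_list_carrier) auto
  \<comment> \<open>As a polynomial function of \<open>W\<close> and \<open>t\<close>, which are the variables \<open>Inl\<close> and \<open>Inr\<close>.\<close>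
  define f where "f e = q (\<lambda>v. entries n (G (e (Inr ()))) v + e (Inr ()) ^ 3 * e (Inl v))"
    for e :: "(nat \<times> nat) + unit \<Rightarrow> complex"
  have "polyfun_mat n (\<lambda>e :: (nat \<times> nat) + unit \<Rightarrow> complex. G (e (Inr ())))"
    unfolding G_def C_def B_def
    by (intro polyfun_mat_prod_list polyfun_mat_add polyfun_mat_smult polyfun_mat_const polyfun.var) auto
  then have "polyfun f" unfolding f_def power3_eq_cube
    by (intro polyfun_subst[OF q] polyfun.add polyfun.mult polyfun.var polyfun_entries)
  moreover have "\<exists>N. poly_family N ((\<lambda>v w. case v of Inl u \<Rightarrow> [:w u :: complex:] | Inr _ \<Rightarrow> [:0, 1:]) v)"
    for v :: "(nat \<times> nat) + unit"
  proof (cases v)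
    case (Inl u)
    then show ?thesis using poly_family_const[OF polyfun.var[of u]] by auto
  next
    case (Inr u)
    then show ?thesis using poly_family_fixed[of "[:0, 1:]"] by simp
  qed
  ultimately obtain N P where P: "poly_family N P"
    "\<forall>w t. f (\<lambda>v. poly (case v of Inl u \<Rightarrow> [:w u:] | Inr _ \<Rightarrow> [:0, 1:]) t) = poly (P w) t"
    using polyfun_subst_poly[of f "\<lambda>v w. case v of Inl u \<Rightarrow> [:w u:] | Inr _ \<Rightarrow> [:0, 1:]"] by blast
  have qP: "q (entries n (G t + t^3 \<cdot>\<^sub>m A)) = poly (P (entries n A)) t" if "A \<in> carrier_mat n n" for A t
  proof -
    have "poly (P (entries n A)) t = q (\<lambda>v. entries n (G t) v + t ^ 3 * entries n A v)"
      using P(2)[THEN spec, THEN spec, of "entries n A" t] by (simp add: f_def)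
    also have "(\<lambda>v. entries n (G t) v + t ^ 3 * entries n A v) = entries n (G t + t^3 \<cdot>\<^sub>m A)"
      using that cG[of t] by (auto simp: entries_def)
    finally show ?thesis by simp
  qed
  have "G 1 + 1^3 \<cdot>\<^sub>m (M - G 1) = M" using M cG[of 1] by (intro eq_matI) auto
  then have "poly (P (entries n (M - G 1))) 1 \<noteq> 0"
    using qP[of "M - G 1" 1] nz cG[of 1] by (simp add: minus_carrier_mat)
  then have "P (entries n (M - G 1)) \<noteq> 0" by auto
  then obtain d where "coeff (P (entries n (M - G 1))) d \<noteq> 0" by (auto simp: poly_eq_iff)
  then have ex: "\<exists>d. \<exists>A\<in>carrier_mat n n. coeff (P (entries n A)) d \<noteq> 0"
    using cG minus_carrier_mat by blast
  define d where "d = (LEAST d. \<exists>A\<in>carrier_mat n n. coeff (P (entries n A)) d \<noteq> 0)"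
  obtain A where A: "A \<in> carrier_mat n n" "coeff (P (entries n A)) d \<noteq> 0"
    using LeastI_ex[OF ex] unfolding d_def by blast
  have less: "coeff (P (entries n A')) l = 0" if "l < d" "A' \<in> carrier_mat n n" for A' l
    using not_less_Least[OF that(1)[unfolded d_def]] that(2) by blast
  have dN: "d < N" using A(2) poly_familyD(2)[OF P(1)] by (meson not_le)
  obtain x y where xy: "y 0 = (\<lambda>d. 0)" "y r = (\<lambda>d. 0)"
    "\<And>i j. i < n \<Longrightarrow> j < n \<Longrightarrow> A $$ (i, j) = x (int j - int i) +
      (\<Sum>k\<le>n div 2. (toep n (y k) * B k) $$ (i, j) - (B k * toep n (y (Suc k))) $$ (i, j))"
    using tangent_surjective[where n = n and M = A] unfolding r_def B_def by auto
  define X where "X k = (if k = 0 then toep n x else 0\<^sub>m n n)" for k :: nat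
  define Y where "Y k = toep n (y k)" for k
  have c: "B k \<in> carrier_mat n n" "X k \<in> carrier_mat n n" "Y k \<in> carrier_mat n n" for k
    by (simp_all add: B_def X_def Y_def)
  have Y0: "Y 0 = 0\<^sub>m n n" "Y r = 0\<^sub>m n n" unfolding Y_def xy by (auto intro!: eq_matI)
  obtain E where E: "polyfun_mat n E"
    "\<And>e. mat_prod_list n (map (\<lambda>k. 1\<^sub>m n + e () \<cdot>\<^sub>m B k + (e ())^2 \<cdot>\<^sub>m (Y (Suc k) - Y k) + (e ())^3 \<cdot>\<^sub>m X k) [0..<r]) =
       G (e ()) * (1\<^sub>m n + (e ())^2 \<cdot>\<^sub>m Y r) + (e ())^3 \<cdot>\<^sub>m E e"
    "\<And>i j. i < n \<Longrightarrow> j < n \<Longrightarrow> E (\<lambda>u. 0) $$ (i, j) = (\<Sum>l<r. (X l + Y l * B l - B l * Y (Suc l)) $$ (i, j))"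
    using product_expansion[of B n X Y r, OF c Y0(1)] unfolding G_def C_def by blast
  have cE: "E e \<in> carrier_mat n n" for e by (rule polyfun_mat_carrier[OF E(1)])
  have E0: "E (\<lambda>u. 0) $$ (i, j) = A $$ (i, j)" if ij: "i < n" "j < n" for i j
  proof -
    have "(X l + Y l * B l - B l * Y (Suc l)) $$ (i, j) =
      (if l = 0 then x (int j - int i) else 0) + ((Y l * B l) $$ (i, j) - (B l * Y (Suc l)) $$ (i, j))" for l
      using ij by (auto simp: X_def Y_def B_def simp del: index_mult_mat(1))
    then have "E (\<lambda>u. 0) $$ (i, j) = (\<Sum>l<r. (if l = 0 then x (int j - int i) else 0) +
        ((Y l * B l) $$ (i, j) - (B l * Y (Suc l)) $$ (i, j)))"
      using E(3)[OF ij] by simp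
    also have "\<dots> = x (int j - int i) + (\<Sum>l<r. (Y l * B l) $$ (i, j) - (B l * Y (Suc l)) $$ (i, j))"
      unfolding sum.distrib by (simp add: r_def)
    also have "\<dots> = A $$ (i, j)"
      using xy(3)[OF ij] by (simp add: r_def Y_def lessThan_Suc_atMost)
    finally show ?thesis .
  qed
  have vanish: "poly (P (entries n (E (\<lambda>u. t)))) t = 0" for t
  proof -
    have "1\<^sub>m n + t \<cdot>\<^sub>m B k + t^2 \<cdot>\<^sub>m (Y (Suc k) - Y k) + t^3 \<cdot>\<^sub>m X k =
      toep n (\<lambda>d. (if d = 0 then 1 else 0) + t * base_symbol n k d + t^2 * (y (Suc k) d - y k d) +
        t^3 * (if k = 0 then x d else 0))" for k
      by (intro eq_matI) (auto simp: B_def Y_def X_def)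
    then have "q (entries n (mat_prod_list n (map (\<lambda>k. 1\<^sub>m n + t \<cdot>\<^sub>m B k + t^2 \<cdot>\<^sub>m (Y (Suc k) - Y k) + t^3 \<cdot>\<^sub>m X k) [0..<r]))) = 0"
      unfolding r_def by (simp only:) (rule zero)
    then have "q (entries n (G t * (1\<^sub>m n + t^2 \<cdot>\<^sub>m Y r) + t^3 \<cdot>\<^sub>m E (\<lambda>u. t))) = 0"
      using E(2)[of "\<lambda>u. t"] by simp
    moreover have "G t * (1\<^sub>m n + t^2 \<cdot>\<^sub>m Y r) = G t"
    proof -
      have "1\<^sub>m n + t^2 \<cdot>\<^sub>m Y r = 1\<^sub>m n" unfolding Y0 by (intro eq_matI) auto
      then show ?thesis using right_mult_one_mat[OF cG] by simp
    qed
    ultimately show ?thesis using qP[OF cE] by simp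
  qed
  \<comment> \<open>The quotient of \<open>q (G(t) + t\<^sup>3 E(t))\<close> by \<open>t\<^sup>d\<close>, which makes sense at \<open>t = 0\<close>.\<close>
  define h where "h t = (\<Sum>l\<in>{d..<N}. coeff (P (entries n (E (\<lambda>u. t)))) l * t ^ (l - d))" for t
  have "continuous_on UNIV h" unfolding h_def
  proof (intro continuous_on_sum continuous_on_mult continuous_on_power continuous_on_id)
    fix l
    have "polyfun (\<lambda>e. coeff (P (entries n (E e))) l)"
      by (intro polyfun_subst[OF poly_familyD(1)[OF P(1)]] polyfun_entries E(1))
    then show "continuous_on UNIV (\<lambda>t. coeff (P (entries n (E (\<lambda>u. t)))) l)"
      by (rule polyfun_continuous) (rule continuous_on_id)
  qed
  then have "(h \<longlongrightarrow> h 0) (at 0)" by (simp add: continuous_on_def)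
  moreover have h0: "h t = 0" if "t \<noteq> 0" for t
  proof -
    define p where "p = P (entries n (E (\<lambda>u. t)))"
    have "degree p < N" 
      using poly_familyD(2)[OF P(1)] dN by (intro degree_lessI) (auto simp: p_def)
    then have "poly p t = (\<Sum>l<N. coeff p l * t ^ l)"
      unfolding poly_altdef by (intro sum.mono_neutral_left) (auto simp: coeff_eq_0)
    also have "\<dots> = (\<Sum>l\<in>{d..<N}. coeff p l * t ^ l)"
      using less[OF _ cE] by (intro sum.mono_neutral_right) (auto simp: p_def)
    also have "\<dots> = (\<Sum>l\<in>{d..<N}. t ^ d * (coeff p l * t ^ (l - d)))"
      by (intro sum.cong refl) (auto simp flip: power_add)
    also have "\<dots> = t ^ d * h t" by (simp add: h_def p_def sum_distrib_left)
    finally show ?thesis using vanish[of t] that by (simp add: p_def)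
  qed
  have "(h \<longlongrightarrow> 0) (at 0)"
    by (rule tendsto_eventually) (auto simp: eventually_at_filter h0)
  ultimately have "h 0 = 0" by (metis tendsto_unique at_neq_bot)
  moreover have "h 0 = coeff (P (entries n A)) d"
  proof -
    have "entries n (E (\<lambda>u. 0)) = entries n A" by (auto simp: entries_def E0)
    moreover have "h 0 = (\<Sum>l\<in>{d}. coeff (P (entries n (E (\<lambda>u. 0)))) l * 0 ^ (l - d))"
      unfolding h_def using dN by (intro sum.mono_neutral_right) auto
    ultimately show ?thesis by simp
  qed
  ultimately show False using A(2) by simp
qed

section \<open>Generic and invertible matrices\<close>

definition toeplitz_product :: "nat \<Rightarrow> nat \<Rightarrow> complex mat \<Rightarrow> bool" where
  "toeplitz_product n k A \<longleftrightarrow> (\<exists>Ts. length Ts = k \<and>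
     (\<forall>T \<in> set Ts. T \<in> carrier_mat n n \<and> toeplitz_mat T) \<and> A = mat_prod_list n Ts)"

lemma toeplitz_product_mult:
  assumes "toeplitz_product n k A" "toeplitz_product n l B"
  shows "toeplitz_product n (k + l) (A * B)"
proof -
  obtain Ts Us where "length Ts = k" "\<forall>T \<in> set Ts. T \<in> carrier_mat n n \<and> toeplitz_mat T" "A = mat_prod_list n Ts"
    "length Us = l" "\<forall>T \<in> set Us. T \<in> carrier_mat n n \<and> toeplitz_mat T" "B = mat_prod_list n Us"
    using assms unfolding toeplitz_product_def by blast
  then show ?thesis unfolding toeplitz_product_def
    by (intro exI[of _ "Ts @ Us"]) (auto simp: mat_prod_list_append)
qed

lemma toeplitz_product_single:
  "A \<in> carrier_mat n n \<Longrightarrow> toeplitz_mat A \<Longrightarrow> toeplitz_product n 1 A"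
  unfolding toeplitz_product_def using right_mult_one_mat[of A n n]
  by (intro exI[of _ "[A]"]) (auto simp: mat_prod_list_def)

lemma toeplitz_mat_smult: "toeplitz_mat A \<Longrightarrow> toeplitz_mat (c \<cdot>\<^sub>m A)"
  unfolding toeplitz_mat_def by (elim exE, rule_tac x = "\<lambda>d. c * f d" in exI) auto

lemma toeplitz_product_smult:
  assumes "toeplitz_product n (Suc k) A"
  shows "toeplitz_product n (Suc k) (c \<cdot>\<^sub>m A)"
proof -
  obtain T Ts where T: "length Ts = k" "\<forall>T \<in> set (T # Ts). T \<in> carrier_mat n n \<and> toeplitz_mat T"
    "A = mat_prod_list n (T # Ts)"
    using assms unfolding toeplitz_product_def by (metis length_Suc_conv)
  have "mat_prod_list n Ts \<in> carrier_mat n n" using T by (intro mat_prod_list_carrier) auto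
  then have "c \<cdot>\<^sub>m A = mat_prod_list n ((c \<cdot>\<^sub>m T) # Ts)"
    using T mult_smult_assoc_mat[of T n n "mat_prod_list n Ts" n c] by (simp add: mat_prod_list_def)
  then show ?thesis unfolding toeplitz_product_def using T
    by (intro exI[of _ "(c \<cdot>\<^sub>m T) # Ts"]) (auto intro: toeplitz_mat_smult)
qed

lemma toeplitz_product_toep: "toeplitz_product n k (mat_prod_list n (map (\<lambda>l. toep n (f l)) [0..<k]))"
  unfolding toeplitz_product_def
  by (intro exI[of _ "map (\<lambda>l. toep n (f l)) [0..<k]"]) (auto intro: toeplitz_mat_toep)

text \<open>
  The set \<open>S'\<close> of products is the projection of the graph \<open>S\<close> of the multiplication map, whose
  variables are the entries (\<open>Inl\<close>) and the values of the symbols (\<open>Inr\<close>). It is not contained in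
  a hypersurface, so it contains the complement of one.
\<close>

theorem generic_toeplitz_product:
  "\<exists>q. polyfun q \<and> (\<exists>M\<in>carrier_mat n n. q (entries n M) \<noteq> 0) \<and>
     (\<forall>M\<in>carrier_mat n n. q (entries n M) \<noteq> 0 \<longrightarrow> toeplitz_product n (n div 2 + 1) M)"
proof -
  define r where "r = n div 2 + 1"
  define F where "F f = mat_prod_list n (map (\<lambda>k. toep n (f k)) [0..<r])" for f :: "nat \<Rightarrow> int \<Rightarrow> complex"
  have cF: "F f \<in> carrier_mat n n" for f unfolding F_def by (intro mat_prod_list_carrier) auto
  define S where "S = {e :: (nat \<times> nat) + (nat \<times> int) \<Rightarrow> complex.
    \<forall>i<n. \<forall>j<n. e (Inl (i, j)) = F (\<lambda>k d. e (Inr (k, d))) $$ (i, j)}"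
  \<comment> \<open>Only the values of the symbols between \<open>- n\<close> and \<open>n\<close> matter; so the projection is along finitely many variables.\<close>
  define I :: "((nat \<times> nat) + (nat \<times> int)) set" where "I = Inr ` ({..<r} \<times> {- int n<..<int n})"
  define S' where "S' = {e. \<exists>x. (\<lambda>v. if v \<in> I then x v else e v) \<in> S}"
  have "polyfun_mat n (\<lambda>e :: (nat \<times> nat) + (nat \<times> int) \<Rightarrow> complex. F (\<lambda>k d. e (Inr (k, d))))"
    unfolding F_def by (intro polyfun_mat_prod_list polyfun_mat_toep polyfun.var)
  then have "{e :: (nat \<times> nat) + (nat \<times> int) \<Rightarrow> complex. e (Inl (i, j)) - F (\<lambda>k d. e (Inr (k, d))) $$ (i, j) = 0} \<in> constructible"
    if "i < n" "j < n" for i j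
    using that by (intro constructible.zero polyfun_diff polyfun.var) (auto simp: polyfun_mat_def)
  then have "(\<Inter>i\<in>{..<n}. \<Inter>j\<in>{..<n}.
    {e :: (nat \<times> nat) + (nat \<times> int) \<Rightarrow> complex. e (Inl (i, j)) - F (\<lambda>k d. e (Inr (k, d))) $$ (i, j) = 0}) \<in> constructible"
    by (intro constructible_INT) auto
  moreover have "(\<Inter>i\<in>{..<n}. \<Inter>j\<in>{..<n}.
    {e :: (nat \<times> nat) + (nat \<times> int) \<Rightarrow> complex. e (Inl (i, j)) - F (\<lambda>k d. e (Inr (k, d))) $$ (i, j) = 0}) = S"
    by (auto simp: S_def)
  ultimately have "S \<in> constructible" by simp
  then have "S' \<in> constructible"
    unfolding S'_def by (intro constructible_projection_finite) (auto simp: I_def)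
  then obtain g e0 where g: "polyfun g" "g e0 \<noteq> 0" "{e. g e \<noteq> 0} \<subseteq> S' \<or> {e. g e \<noteq> 0} \<inter> S' = {}"
    using constructible_dichotomy[of S'] by blast
  \<comment> \<open>The polynomial \<open>g\<close> may involve variables other than the entries; these are fixed to their values in \<open>e0\<close>.\<close>
  define env where "env w = (\<lambda>v. case v of Inl u \<Rightarrow> if fst u < n \<and> snd u < n then w u else e0 v | Inr _ \<Rightarrow> e0 v)"
    for w :: "nat \<times> nat \<Rightarrow> complex"
  have Inl_I: "Inl u \<notin> I" for u by (auto simp: I_def)
  have env_Inl: "env (entries n M) (Inl (i, j)) = M $$ (i, j)" if "i < n" "j < n" for M i j
    using that by (simp add: env_def entries_def)
  have env_S': "env (entries n M) \<in> S' \<longleftrightarrow> (\<exists>f. M = F f)" if M: "M \<in> carrier_mat n n" for M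
  proof
    assume "env (entries n M) \<in> S'"
    then obtain x where "(\<lambda>v. if v \<in> I then x v else env (entries n M) v) \<in> S" by (auto simp: S'_def)
    then have "M = F (\<lambda>k d. if Inr (k, d) \<in> I then x (Inr (k, d)) else env (entries n M) (Inr (k, d)))"
      using M cF by (intro eq_carrier_matI) (auto simp: S_def Inl_I env_Inl)
    then show "\<exists>f. M = F f" by blast
  next
    assume "\<exists>f. M = F f"
    then obtain f where f: "M = F f" by blast
    define x :: "(nat \<times> nat) + (nat \<times> int) \<Rightarrow> complex" where "x v = (case v of Inl u \<Rightarrow> 0 | Inr (k, d) \<Rightarrow> f k d)" for v
    have "toep n (\<lambda>d. if Inr (k, d) \<in> I then x (Inr (k, d)) else env (entries n M) (Inr (k, d))) = toep n (f k)"
      if "k < r" for k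
      using that by (intro eq_matI) (auto simp: I_def x_def)
    then have "F (\<lambda>k d. if Inr (k, d) \<in> I then x (Inr (k, d)) else env (entries n M) (Inr (k, d))) = F f"
      unfolding F_def by (intro arg_cong[of _ _ "mat_prod_list n"] map_cong) auto
    then have "(\<lambda>v. if v \<in> I then x v else env (entries n M) v) \<in> S"
      using f by (auto simp: S_def Inl_I env_Inl)
    then show "env (entries n M) \<in> S'" by (auto simp: S'_def)
  qed
  define q where "q w = g (env w)" for w
  have q: "polyfun q" unfolding q_def
  proof (rule polyfun_subst[OF g(1)])
    fix v show "polyfun (\<lambda>w. env w v)"
      by (cases v; cases "fst (projl v) < n \<and> snd (projl v) < n") (auto simp: env_def intro: polyfun.intros)
  qed
  define M0 where "M0 = mat n n (\<lambda>u. e0 (Inl u))"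
  have M0: "M0 \<in> carrier_mat n n" by (simp add: M0_def)
  have "env (entries n M0) = e0"
    by (auto simp: env_def entries_def M0_def fun_eq_iff split: sum.split)
  then have q0: "q (entries n M0) \<noteq> 0" using g(2) by (simp add: q_def)
  have "{e. g e \<noteq> 0} \<subseteq> S'"
  proof (rule ccontr)
    assume "\<not> {e. g e \<noteq> 0} \<subseteq> S'"
    then have "g e = 0" if "e \<in> S'" for e using g(3) that by blast
    then have "q (entries n (F f)) = 0" for f using env_S'[OF cF] by (auto simp: q_def)
    then have "q (entries n M0) = 0"
      unfolding F_def r_def by (intro vanishes_on_products_imp_zero[OF q _ M0])
    then show False using q0 by simp
  qed
  then have "toeplitz_product n r M" if "M \<in> carrier_mat n n" "q (entries n M) \<noteq> 0" for M
    using that env_S'[OF that(1)] toeplitz_product_toep unfolding q_def F_def by blast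
  then show ?thesis using q q0 M0 unfolding r_def by blast
qed

lemma polyfun_det:
  assumes "polyfun_mat n F"
  shows "polyfun (\<lambda>e. det (F e))"
proof -
  have "(\<lambda>e. det (F e)) = (\<lambda>e. \<Sum>p | p permutes {0..<n}. signof p * (\<Prod>i=0..<n. F e $$ (i, p i)))"
    using polyfun_mat_carrier[OF assms] by (intro ext det_def')
  moreover have "polyfun (\<lambda>e. \<Sum>p | p permutes {0..<n}. signof p * (\<Prod>i=0..<n. F e $$ (i, p i)))" using assms
    by (intro polyfun_sum polyfun.mult polyfun.const polyfun_prod)
      (auto simp: polyfun_mat_def permutes_in_image)
  ultimately show ?thesis by simp
qed

lemma polyfun_mat_adj:
  assumes "polyfun_mat n F"
  shows "polyfun_mat n (\<lambda>e. adj_mat (F e))"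
  unfolding polyfun_mat_def
proof (intro conjI allI impI)
  note c = polyfun_mat_carrier[OF assms]
  show "adj_mat (F e) \<in> carrier_mat n n" for e by (rule adj_mat(1)[OF c])
  fix i j assume ij: "i < n" "j < n"
  have "polyfun_mat (n - 1) (\<lambda>e. mat_delete (F e) j i)"
    unfolding polyfun_mat_def
  proof (intro conjI allI impI)
    show "mat_delete (F e) j i \<in> carrier_mat (n - 1) (n - 1)" for e by (rule mat_delete_carrier[OF c])
    fix a b assume ab: "a < n - 1" "b < n - 1"
    have "(\<lambda>e. mat_delete (F e) j i $$ (a, b)) =
      (\<lambda>e. F e $$ (if a < j then a else Suc a, if b < i then b else Suc b))"
      using carrier_matD[OF c] ab by (intro ext) (simp add: mat_delete_def)
    then show "polyfun (\<lambda>e. mat_delete (F e) j i $$ (a, b))"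
      using assms ab by (auto simp: polyfun_mat_def)
  qed
  then have "polyfun (\<lambda>e. (- 1) ^ (j + i) * det (mat_delete (F e) j i))"
    by (intro polyfun.mult polyfun.const polyfun_det)
  moreover have "(\<lambda>e. adj_mat (F e) $$ (i, j)) = (\<lambda>e. (- 1) ^ (j + i) * det (mat_delete (F e) j i))"
    using carrier_matD[OF c] ij by (intro ext) (simp add: adj_mat_def cofactor_def)
  ultimately show "polyfun (\<lambda>e. adj_mat (F e) $$ (i, j))" by simp
qed

lemma det_adj_nonzero:
  fixes A :: "'a :: field mat"
  assumes A: "A \<in> carrier_mat n n" "det A \<noteq> 0"
  shows "det (adj_mat A) \<noteq> 0"
proof -
  have "det A * det (adj_mat A) = det (det A \<cdot>\<^sub>m 1\<^sub>m n)"
    using adj_mat[OF A(1)] A(1) by (metis det_mult)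
  then show ?thesis using A(2) by auto
qed

text \<open>
  Look for \<open>X\<close> and a scalar \<open>u\<close> such that \<open>X\<close> and \<open>U = u * adj X * A\<close> are both generic; then
  \<open>X * U\<close> is the multiple \<open>u * det X\<close> of \<open>A\<close>, and the scalar can be absorbed into a factor. Using the adjugate instead of the
  inverse keeps all conditions polynomial in \<open>X\<close> and \<open>u\<close>, so that it is enough to satisfy
  each of them separately. For the condition on \<open>U\<close>, choose a generic invertible \<open>Y\<close>
  and solve \<open>U = Y\<close>.
\<close>

theorem invertible_toeplitz_product:
  assumes A: "A \<in> carrier_mat n n" "det A \<noteq> 0"
  shows "toeplitz_product n (2 * (n div 2 + 1)) A"
proof -
  obtain q M0 where q: "polyfun q" and M0: "M0 \<in> carrier_mat n n" "q (entries n M0) \<noteq> 0"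
    and gen: "\<And>M. M \<in> carrier_mat n n \<Longrightarrow> q (entries n M) \<noteq> 0 \<Longrightarrow> toeplitz_product n (n div 2 + 1) M"
    using generic_toeplitz_product[of n] by blast
  define X where "X e = mat n n (\<lambda>u. e (Inl u))" for e :: "(nat \<times> nat) + unit \<Rightarrow> complex"
  define pt :: "complex mat \<Rightarrow> complex \<Rightarrow> (nat \<times> nat) + unit \<Rightarrow> complex"
    where "pt M u = (\<lambda>v. case v of Inl w \<Rightarrow> entries n M w | Inr _ \<Rightarrow> u)" for M u
  have X: "X e \<in> carrier_mat n n" for e by (simp add: X_def)
  have X_pt: "X (pt M u) = M" if "M \<in> carrier_mat n n" for M u
    using that by (intro eq_carrier_matI) (auto simp: X_def pt_def entries_def)
  define U where "U e = e (Inr ()) \<cdot>\<^sub>m (adj_mat (X e) * A)" for e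
  have pX: "polyfun_mat n X" using X by (auto simp: polyfun_mat_def X_def intro: polyfun.var)
  have pU: "polyfun_mat n U" unfolding U_def
    by (intro polyfun_mat_smult polyfun_mat_mult polyfun_mat_adj pX polyfun.var polyfun_mat_const A)
  have p1: "polyfun (\<lambda>e. q (entries n (X e)))" "polyfun (\<lambda>e. q (entries n (U e)))"
    by (rule polyfun_subst[OF q polyfun_entries[OF pX]], rule polyfun_subst[OF q polyfun_entries[OF pU]])
  have p2: "polyfun (\<lambda>e. det (X e))" by (rule polyfun_det[OF pX])
  have p3: "polyfun (\<lambda>e. q (entries n (X e)) * det (X e))" by (rule polyfun.mult[OF p1(1) p2])
  have p4: "polyfun (\<lambda>e. q (entries n (X e)) * det (X e) * e (Inr ()))" by (rule polyfun.mult[OF p3 polyfun.var])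
  obtain e1 where e1: "q (entries n (X e1)) * det (X e1) \<noteq> 0"
    using polyfun_mult_nonzero[OF p1(1) p2, of "pt M0 0" "pt (1\<^sub>m n) 0"] M0 by (auto simp: X_pt)
  define Y where "Y = X e1"
  have Y: "Y \<in> carrier_mat n n" "det Y \<noteq> 0" "q (entries n Y) \<noteq> 0" using e1 X by (auto simp: Y_def)
  \<comment> \<open>Up to a scalar, \<open>Z\<close> is \<open>A\<close> times the inverse of \<open>Y\<close>; the scalar \<open>u\<close> corrects for the difference.\<close>
  define Z where "Z = A * adj_mat Y"
  have Z: "Z \<in> carrier_mat n n" "det Z \<noteq> 0"
    using A adj_mat(1)[OF Y(1)] det_adj_nonzero[OF Y(1,2)] unfolding Z_def by (auto simp: det_mult)
  have "U (pt Z (det Y / det Z)) = Y"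
  proof -
    have aZ: "adj_mat Z \<in> carrier_mat n n" and aY: "adj_mat Y \<in> carrier_mat n n"
      using adj_mat(1) Y Z by auto
    have "det Y \<cdot>\<^sub>m (adj_mat Z * A) = adj_mat Z * A * (det Y \<cdot>\<^sub>m 1\<^sub>m n)"
      using aZ A by (simp add: mult_smult_distrib[of _ n n _ n] right_mult_one_mat[of _ n n] mult_carrier_mat[of _ n n _ n])
    also have "\<dots> = adj_mat Z * A * (adj_mat Y * Y)" using adj_mat(3)[OF Y(1)] by simp
    also have "\<dots> = (adj_mat Z * Z) * Y"
      using aZ aY A Y by (simp add: Z_def mult_carrier_mat[of _ n n _ n] assoc_mult_mat[of _ n n _ n _ n])
    also have "\<dots> = det Z \<cdot>\<^sub>m Y"
      using adj_mat(3)[OF Z(1)] Y by (simp add: mult_smult_assoc_mat[of _ n n _ n] left_mult_one_mat[of _ n n])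
    finally have eq: "det Y \<cdot>\<^sub>m (adj_mat Z * A) = det Z \<cdot>\<^sub>m Y" .
    have "U (pt Z (det Y / det Z)) = (det Y / det Z) \<cdot>\<^sub>m (adj_mat Z * A)"
      by (simp add: U_def X_pt[OF Z(1)]) (simp add: pt_def)
    also have "\<dots> = (1 / det Z) \<cdot>\<^sub>m (det Y \<cdot>\<^sub>m (adj_mat Z * A))"
      by (intro eq_matI) auto
    also have "\<dots> = Y" unfolding eq using Z(2) Y(1) by (intro eq_matI) auto
    finally show ?thesis .
  qed
  then have nzU: "q (entries n (U (pt Z (det Y / det Z)))) \<noteq> 0" using Y by simp
  obtain e2 where e2: "q (entries n (X e2)) * det (X e2) * e2 (Inr ()) \<noteq> 0"
    using polyfun_mult_nonzero[OF p3 polyfun.var[of "Inr ()"], of e1 "pt Y 1"] e1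
    by (auto simp: pt_def)
  obtain e where e: "q (entries n (X e)) * det (X e) * e (Inr ()) * q (entries n (U e)) \<noteq> 0"
    using polyfun_mult_nonzero[OF p4 p1(2), of e2 "pt Z (det Y / det Z)"] e2 nzU by blast
  define c where "c = e (Inr ()) * det (X e)"
  have c: "c \<noteq> 0" using e by (auto simp: c_def)
  have aX: "adj_mat (X e) \<in> carrier_mat n n" by (rule adj_mat(1)[OF X])
  have "X e * U e = e (Inr ()) \<cdot>\<^sub>m (X e * adj_mat (X e) * A)"
    using X aX A by (simp add: U_def mult_smult_distrib[of _ n n _ n] mult_carrier_mat[of _ n n _ n] assoc_mult_mat[of _ n n _ n _ n])
  also have "\<dots> = c \<cdot>\<^sub>m A"
    using A by (simp add: adj_mat(2)[OF X] mult_smult_assoc_mat[of _ n n _ n] left_mult_one_mat[of _ n n])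
      (auto simp: c_def intro!: eq_matI)
  finally have "A = (1 / c) \<cdot>\<^sub>m (X e * U e)" using c A by (auto intro!: eq_matI)
  moreover have "toeplitz_product n (n div 2 + 1 + (n div 2 + 1)) (X e * U e)"
    using e X polyfun_mat_carrier[OF pU] by (intro toeplitz_product_mult gen) auto
  ultimately show ?thesis
    using toeplitz_product_smult[of n "n div 2 + (n div 2 + 1)" "X e * U e" "1 / c"] by (simp add: mult_2)
qed

section \<open>Arbitrary matrices\<close>

definition partial_identity :: "nat \<Rightarrow> nat \<Rightarrow> 'a :: field mat" where
  "partial_identity n k = mat n n (\<lambda>(i, j). if i = j \<and> i < k then 1 else 0)"

definition equivalent_mat :: "nat \<Rightarrow> 'a :: field mat \<Rightarrow> 'a mat \<Rightarrow> bool" where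
  "equivalent_mat n A B \<longleftrightarrow> (\<exists>P\<in>carrier_mat n n. \<exists>Q\<in>carrier_mat n n.
     det P \<noteq> 0 \<and> det Q \<noteq> 0 \<and> A = P * B * Q)"

lemma equivalent_matI:
  "P \<in> carrier_mat n n \<Longrightarrow> Q \<in> carrier_mat n n \<Longrightarrow> det P \<noteq> 0 \<Longrightarrow> det Q \<noteq> 0 \<Longrightarrow> A = P * B * Q \<Longrightarrow>
    equivalent_mat n A B"
  by (auto simp: equivalent_mat_def)

lemma equivalent_mat_trans:
  assumes "equivalent_mat n A B" "equivalent_mat n B C" "C \<in> carrier_mat n n"
  shows "equivalent_mat n A C"
proof -
  obtain P Q P' Q' where c: "P \<in> carrier_mat n n" "Q \<in> carrier_mat n n" "P' \<in> carrier_mat n n" "Q' \<in> carrier_mat n n"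
    and d: "det P \<noteq> 0" "det Q \<noteq> 0" "det P' \<noteq> 0" "det Q' \<noteq> 0"
    and eq: "A = P * B * Q" "B = P' * C * Q'"
    using assms(1,2) unfolding equivalent_mat_def by blast
  have "A = (P * P') * C * (Q' * Q)"
    unfolding eq using c assms(3) by (simp add: mult_carrier_mat[of _ n n _ n] assoc_mult_mat[of _ n n _ n _ n])
  then show ?thesis
    using c d by (intro equivalent_matI[of "P * P'" _ "Q' * Q"]) (auto simp: det_mult)
qed

text \<open>
  Gaussian elimination by rows and columns: move a nonzero entry to the corner, clear its row and
  column, and continue with the remaining block.
\<close>

lemma equivalent_partial_identity:
  "A \<in> carrier_mat n n \<Longrightarrow> \<exists>k\<le>n. equivalent_mat n A (partial_identity n k)"
proof (induction n arbitrary: A)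
  case 0
  then show ?case
    by (intro exI[of _ 0] conjI equivalent_matI[of "1\<^sub>m 0" _ "1\<^sub>m 0"]) (auto intro!: eq_matI)
next
  case (Suc n)
  show ?case
  proof (cases "A = 0\<^sub>m (Suc n) (Suc n)")
    case True
    have "partial_identity (Suc n) 0 = (0\<^sub>m (Suc n) (Suc n) :: 'a mat)"
      by (intro eq_matI) (auto simp: partial_identity_def)
    then show ?thesis using True
      by (intro exI[of _ 0] conjI equivalent_matI[of "1\<^sub>m (Suc n)" _ "1\<^sub>m (Suc n)"])
        (auto simp: left_mult_one_mat[of _ "Suc n" "Suc n"] right_mult_one_mat[of _ "Suc n" "Suc n"])
  next
    case False
    then obtain i j where ij: "i < Suc n" "j < Suc n" "A $$ (i, j) \<noteq> 0"
      using Suc.prems by (metis eq_carrier_matI index_zero_mat(1) zero_carrier_mat)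
    define S :: "nat \<Rightarrow> 'a mat" where "S k = swaprows_mat (Suc n) 0 k" for k
    have cS: "S k \<in> carrier_mat (Suc n) (Suc n)" for k by (simp add: S_def)
    have SS: "S k * S k = 1\<^sub>m (Suc n)" if "k < Suc n" for k
      unfolding S_def using that by (intro swaprows_mat_inv) auto
    have dS: "det (S k) \<noteq> 0" if "k < Suc n" for k
    proof -
      have "det (S k) * det (S k) = 1" using arg_cong[OF SS[OF that], of det] det_mult[OF cS cS] by simp
      then show ?thesis by auto
    qed
    define A' where "A' = S i * A * S j"
    have cA': "A' \<in> carrier_mat (Suc n) (Suc n)"
      using cS Suc.prems unfolding A'_def by (simp add: mult_carrier_mat[of _ "Suc n" "Suc n" _ "Suc n"])
    have "A' = swapcols 0 j (swaprows 0 i A)"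
      using swaprows_mat[OF Suc.prems, of 0 i] swapcols_mat[of "swaprows 0 i A" "Suc n" "Suc n" 0 j] ij
        mult_carrier_mat[OF cS Suc.prems, of i]
      by (simp add: A'_def S_def)
    then have a: "A' $$ (0, 0) \<noteq> 0" using ij Suc.prems by auto
    have "S i * A' * S j = (S i * S i) * A * (S j * S j)"
      unfolding A'_def using cS Suc.prems
      by (simp add: mult_carrier_mat[of _ "Suc n" "Suc n" _ "Suc n"] assoc_mult_mat[of _ "Suc n" "Suc n" _ "Suc n" _ "Suc n"])
    then have "A = S i * A' * S j"
      using SS ij Suc.prems by (simp add: left_mult_one_mat[of _ "Suc n" "Suc n"] right_mult_one_mat[of _ "Suc n" "Suc n"])
    then have eq1: "equivalent_mat (Suc n) A A'"
      using cS dS ij by (intro equivalent_matI[of "S i" _ "S j"])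
    obtain A1 A2 A3 A4 where split: "split_block A' 1 1 = (A1, A2, A3, A4)" by (metis prod_cases4)
    have blocks: "A1 \<in> carrier_mat 1 1" "A2 \<in> carrier_mat 1 n" "A3 \<in> carrier_mat n 1" "A4 \<in> carrier_mat n n"
      "A' = four_block_mat A1 A2 A3 A4"
      using split_block[OF split, of n n] cA' by auto
    define a where "a = A1 $$ (0, 0)"
    have a0: "a \<noteq> 0" using a blocks by (auto simp: a_def)
    have A1: "A1 = a \<cdot>\<^sub>m 1\<^sub>m 1" using blocks(1) by (intro eq_matI) (auto simp: a_def)
    define w where "w = (1 / a) \<cdot>\<^sub>m A3"
    define C where "C = A4 - w * A2"
    have w: "w \<in> carrier_mat n 1" using blocks by (simp add: w_def)
    have C: "C \<in> carrier_mat n n" using w blocks by (auto simp: C_def intro!: minus_carrier_mat)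
    define L where "L = four_block_mat (1\<^sub>m 1) (0\<^sub>m 1 n) w (1\<^sub>m n)"
    define U where "U = four_block_mat A1 A2 (0\<^sub>m n 1) (1\<^sub>m n)"
    define D where "D M = four_block_mat (1\<^sub>m 1) (0\<^sub>m 1 n) (0\<^sub>m n 1) M" for M :: "'a mat"
    have cD: "D M \<in> carrier_mat (Suc n) (Suc n)" if "M \<in> carrier_mat n n" for M
      using four_block_carrier_mat[OF one_carrier_mat[of 1] that, of "0\<^sub>m 1 n" "0\<^sub>m n 1"] by (simp add: D_def)
    have cL: "L \<in> carrier_mat (Suc n) (Suc n)"
      using four_block_carrier_mat[OF one_carrier_mat[of 1] one_carrier_mat[of n], of "0\<^sub>m 1 n" w] by (simp add: L_def)
    have cU: "U \<in> carrier_mat (Suc n) (Suc n)"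
      using four_block_carrier_mat[OF blocks(1) one_carrier_mat[of n], of A2 "0\<^sub>m n 1"] by (simp add: U_def)
    have DM: "D M * D N = D (M * N)" if "M \<in> carrier_mat n n" "N \<in> carrier_mat n n" for M N
      unfolding D_def using that
      by (subst mult_four_block_mat[of _ 1 1 _ n _ n _ _ 1 _ n])
        (auto simp: left_add_zero_mat[of _ n n] left_mult_zero_mat[of _ n n] right_mult_zero_mat[of _ n n])
    have detD: "det (D M) = det M" if "M \<in> carrier_mat n n" for M
      unfolding D_def using that
      by (subst det_four_block_mat_upper_right_zero[of _ 1 _ n]) auto
    have detL: "det L \<noteq> 0" unfolding L_def using w
      by (subst det_four_block_mat_upper_right_zero[of _ 1 _ n]) auto
    have detU: "det U \<noteq> 0" unfolding U_def using blocks a0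
      by (subst det_four_block_mat_lower_left_zero[of _ 1 _ n]) (auto simp: A1)
    have "L * D C = four_block_mat (1\<^sub>m 1) (0\<^sub>m 1 n) w C"
      unfolding L_def D_def using w C
      by (subst mult_four_block_mat[of _ 1 1 _ n _ n _ _ 1 _ n]) auto
    also have "\<dots> * U = four_block_mat A1 A2 (w * A1) (w * A2 + C)"
      unfolding U_def using w C blocks
      by (subst mult_four_block_mat[of _ 1 1 _ n _ n _ _ 1 _ n]) auto
    also have "w * A1 = A3"
      unfolding A1 w_def using blocks(3) a0 by (auto simp: mult_smult_distrib[of _ n 1 _ 1] intro!: eq_matI)
    also have "w * A2 + C = A4" unfolding C_def using w blocks by (intro eq_matI) auto
    finally have eq2: "equivalent_mat (Suc n) A' (D C)"
      using cL cU detL detU blocks(5) by (intro equivalent_matI[of L _ U]) auto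
    obtain k P Q where k: "k \<le> n" and PQ: "P \<in> carrier_mat n n" "Q \<in> carrier_mat n n" "det P \<noteq> 0" "det Q \<noteq> 0"
      "C = P * partial_identity n k * Q"
      using Suc.IH[OF C] unfolding equivalent_mat_def by blast
    have pid: "(partial_identity n k :: 'a mat) \<in> carrier_mat n n" for n k by (simp add: partial_identity_def)
    have "D C = D P * D (partial_identity n k) * D Q"
      unfolding PQ(5) using DM[OF PQ(1) pid, of k] DM[OF mult_carrier_mat[OF PQ(1) pid] PQ(2), of k] by simp
    moreover have "D (partial_identity n k) = partial_identity (Suc n) (Suc k)"
      unfolding D_def by (intro eq_matI) (auto simp: partial_identity_def)
    ultimately have eq3: "equivalent_mat (Suc n) (D C) (partial_identity (Suc n) (Suc k))"
      using PQ cD detD by (intro equivalent_matI[of "D P" _ "D Q"]) auto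
    show ?thesis using k eq1 eq2 eq3 equivalent_mat_trans cD[OF C] pid by (intro exI[of _ "Suc k"]) blast
  qed
qed

text \<open>
  A permutation of the columns moves the \<open>k\<close> ones from the main diagonal to the superdiagonal at
  distance \<open>n - k\<close>, which has exactly \<open>k\<close> entries. The result is Toeplitz of rank \<open>k\<close>.
\<close>

lemma partial_identity_shift:
  assumes "k \<le> n"
  shows "equivalent_mat n (partial_identity n k :: complex mat) (toep n (\<lambda>d. if d = int (n - k) then 1 else 0))"
proof -
  \<comment> \<open>The cyclic shift of the indices by \<open>n - k\<close>, and its inverse.\<close>
  define s where "s l = (if l < k then l + (n - k) else l - k)" for l
  define t where "t i = (if i < n - k then i + k else i - (n - k))" for i
  define C :: "complex mat" where "C = mat n n (\<lambda>(i, l). if i = s l then 1 else 0)"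
  define C' :: "complex mat" where "C' = mat n n (\<lambda>(l, j). if j = s l then 1 else 0)"
  have st: "i = s l \<longleftrightarrow> l = t i" if "i < n" "l < n" for i l
    using that assms unfolding s_def t_def by auto
  have tn: "t i < n" if "i < n" for i using that assms unfolding t_def by auto
  have sn: "s i < n" if "i < n" for i using that assms unfolding s_def by auto
  have cC: "C \<in> carrier_mat n n" "C' \<in> carrier_mat n n" by (simp_all add: C_def C'_def)
  have "C * C' = 1\<^sub>m n"
  proof (rule eq_carrier_matI)
    fix i j assume ij: "i < n" "j < n"
    have "(C * C') $$ (i, j) = (\<Sum>l<n. if l = t i then (if l = t j then 1 else 0) else 0)"
      unfolding mat_mult_index[OF cC ij] using ij by (intro sum.cong) (auto simp: C_def C'_def st)
    also have "\<dots> = (if t i = t j then 1 else 0)" using tn[OF ij(1)] by simp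
    also have "t i = t j \<longleftrightarrow> i = j" using ij st tn by metis
    finally show "(C * C') $$ (i, j) = 1\<^sub>m n $$ (i, j)" using ij by simp
  qed (use cC in auto)
  then have "det C * det C' = 1" using det_mult[OF cC] by simp
  then have "det C \<noteq> 0" by auto
  moreover have "partial_identity n k = 1\<^sub>m n * toep n (\<lambda>d. if d = int (n - k) then 1 else 0) * C"
  proof (rule eq_carrier_matI)
    fix i j assume ij: "i < n" "j < n"
    have "(toep n (\<lambda>d. if d = int (n - k) then 1 else 0) * C) $$ (i, j) =
      (\<Sum>l<n. if l = s j then (if int l - int i = int (n - k) then 1 else 0) else 0)"
      unfolding mat_mult_index[OF toep_carrier cC(1) ij] using ij by (intro sum.cong) (auto simp: C_def)
    also have "\<dots> = (if int (s j) - int i = int (n - k) then 1 else 0)" using sn[OF ij(2)] by simp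
    also have "\<dots> = partial_identity n k $$ (i, j)"
      using ij assms by (auto simp: partial_identity_def s_def)
    finally show "partial_identity n k $$ (i, j) =
      (1\<^sub>m n * toep n (\<lambda>d. if d = int (n - k) then 1 else 0) * C) $$ (i, j)"
      by (simp add: left_mult_one_mat[of _ n n])
  qed (use cC in \<open>auto simp: partial_identity_def\<close>)
  ultimately show ?thesis using cC by (intro equivalent_matI[of "1\<^sub>m n" _ C]) auto
qed

theorem toeplitz_product_all:
  fixes A :: "complex mat"
  assumes "A \<in> carrier_mat n n"
  shows "toeplitz_product n (4 * (n div 2 + 1) + 1) A"
proof -
  obtain k where k: "k \<le> n" "equivalent_mat n A (partial_identity n k)"
    using equivalent_partial_identity[OF assms] by blast
  define E :: "complex mat" where "E = toep n (\<lambda>d. if d = int (n - k) then 1 else 0)"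
  have "equivalent_mat n A E"
    unfolding E_def using equivalent_mat_trans[OF k(2) partial_identity_shift[OF k(1)]] by simp
  then obtain P Q where PQ: "P \<in> carrier_mat n n" "Q \<in> carrier_mat n n" "det P \<noteq> 0" "det Q \<noteq> 0" "A = P * E * Q"
    unfolding equivalent_mat_def by blast
  have "toeplitz_product n 1 E" unfolding E_def by (intro toeplitz_product_single toeplitz_mat_toep) simp
  then have "toeplitz_product n (2 * (n div 2 + 1) + 1 + 2 * (n div 2 + 1)) A"
    unfolding PQ(5) using PQ by (intro toeplitz_product_mult invertible_toeplitz_product)
  moreover have "2 * m + 1 + 2 * m = 4 * m + 1" for m :: nat by simp
  ultimately show ?thesis by (simp only:)
qed

section \<open>Hankel matrices\<close>

definition exchange_mat :: "nat \<Rightarrow> complex mat" where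
  "exchange_mat n = mat n n (\<lambda>(i, j). if i + j = n - 1 then 1 else 0)"

lemma exchange_mat_carrier: "exchange_mat n \<in> carrier_mat n n"
  by (simp add: exchange_mat_def)

lemma mult_exchange_mat_index:
  assumes "A \<in> carrier_mat n n" "i < n" "j < n"
  shows "(A * exchange_mat n) $$ (i, j) = A $$ (i, n - 1 - j)"
    and "(exchange_mat n * A) $$ (i, j) = A $$ (n - 1 - i, j)"
proof -
  have "(A * exchange_mat n) $$ (i, j) = (\<Sum>l<n. if l = n - 1 - j then A $$ (i, l) else 0)"
    unfolding mat_mult_index[OF assms(1) exchange_mat_carrier assms(2,3)]
    using assms by (intro sum.cong) (auto simp: exchange_mat_def)
  then show "(A * exchange_mat n) $$ (i, j) = A $$ (i, n - 1 - j)" using assms by simp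
  have "(exchange_mat n * A) $$ (i, j) = (\<Sum>l<n. if l = n - 1 - i then A $$ (l, j) else 0)"
    unfolding mat_mult_index[OF exchange_mat_carrier assms]
    using assms by (intro sum.cong) (auto simp: exchange_mat_def)
  then show "(exchange_mat n * A) $$ (i, j) = A $$ (n - 1 - i, j)" using assms by simp
qed

lemma exchange_mat_square: "exchange_mat n * exchange_mat n = 1\<^sub>m n"
proof (rule eq_carrier_matI)
  fix i j assume "i < n" "j < n"
  then show "(exchange_mat n * exchange_mat n) $$ (i, j) = 1\<^sub>m n $$ (i, j)"
    unfolding mult_exchange_mat_index(1)[OF exchange_mat_carrier \<open>i < n\<close> \<open>j < n\<close>]
    by (auto simp: exchange_mat_def)
qed (auto intro: mult_carrier_mat exchange_mat_carrier)

lemma hankel_mat_exchange: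
  assumes A: "A \<in> carrier_mat n n" "toeplitz_mat A"
  shows "hankel_mat (A * exchange_mat n)" "hankel_mat (exchange_mat n * A)"
proof -
  obtain f where f: "\<And>i j. i < n \<Longrightarrow> j < n \<Longrightarrow> A $$ (i, j) = f (int j - int i)"
    using A unfolding toeplitz_mat_def by auto
  have d: "dim_row (A * exchange_mat n) = n" "dim_col (A * exchange_mat n) = n"
    "dim_row (exchange_mat n * A) = n" "dim_col (exchange_mat n * A) = n"
    using A by (auto simp: exchange_mat_def)
  have "(A * exchange_mat n) $$ (i, j) = f (int n - 1 - int (i + j))" if "i < n" "j < n" for i j
    using that mult_exchange_mat_index(1)[OF A(1) that] f[of i "n - 1 - j"] by (simp add: of_nat_diff algebra_simps)
  then show "hankel_mat (A * exchange_mat n)"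
    unfolding hankel_mat_def d by (intro exI[of _ "\<lambda>s. f (int n - 1 - int s)"]) blast
  have "(exchange_mat n * A) $$ (i, j) = f (int (i + j) - (int n - 1))" if "i < n" "j < n" for i j
    using that mult_exchange_mat_index(2)[OF A(1) that] f[of "n - 1 - i" j] by (simp add: of_nat_diff algebra_simps)
  then show "hankel_mat (exchange_mat n * A)"
    unfolding hankel_mat_def d by (intro exI[of _ "\<lambda>s. f (int s - (int n - 1))"]) blast
qed

text \<open>
  Alternate \<open>T\<^sub>1 J, J T\<^sub>2, T\<^sub>3 J, ...\<close>: the inner exchange matrices cancel in pairs. Since the
  number of factors is odd, the last one is \<open>T J\<close> and its \<open>J\<close> remains.
\<close>

lemma hankel_from_toeplitz_factors:
  assumes "length Ts = 2 * p + 1" "\<forall>T \<in> set Ts. T \<in> carrier_mat n n \<and> toeplitz_mat T"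
  shows "\<exists>Hs. length Hs = 2 * p + 1 \<and> (\<forall>H \<in> set Hs. H \<in> carrier_mat n n \<and> hankel_mat H) \<and>
    mat_prod_list n Hs = mat_prod_list n Ts * exchange_mat n"
  using assms
proof (induction p arbitrary: Ts)
  case 0
  then obtain T where T: "Ts = [T]" "T \<in> carrier_mat n n" "toeplitz_mat T" by (auto simp: length_Suc_conv)
  then show ?case using hankel_mat_exchange(1)[OF T(2,3)] mult_carrier_mat[OF T(2) exchange_mat_carrier]
    by (intro exI[of _ "[T * exchange_mat n]"]) (simp add: mat_prod_list_def right_mult_one_mat[of _ n n])
next
  case (Suc p)
  let ?J = "exchange_mat n"
  obtain S T Us where Ts: "Ts = S # T # Us" "length Us = 2 * p + 1"
    using Suc.prems(1) by (auto simp: length_Suc_conv)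
  have ST: "S \<in> carrier_mat n n" "T \<in> carrier_mat n n" "toeplitz_mat S" "toeplitz_mat T"
    and Us: "\<forall>T \<in> set Us. T \<in> carrier_mat n n \<and> toeplitz_mat T"
    using Suc.prems(2) Ts by auto
  obtain Hs where Hs: "length Hs = 2 * p + 1" "\<forall>H \<in> set Hs. H \<in> carrier_mat n n \<and> hankel_mat H"
    "mat_prod_list n Hs = mat_prod_list n Us * ?J"
    using Suc.IH[OF Ts(2) Us] by blast
  define U where "U = mat_prod_list n Us"
  have U: "U \<in> carrier_mat n n" unfolding U_def using Us by (intro mat_prod_list_carrier) auto
  note J = exchange_mat_carrier[of n]
  have "mat_prod_list n ((S * ?J) # (?J * T) # Hs) = S * ?J * (?J * T * (U * ?J))"
    using Hs(3) by (simp add: mat_prod_list_def U_def)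
  also have "\<dots> = S * (?J * ?J) * (T * (U * ?J))"
    using ST U J by (simp add: mult_carrier_mat[of _ n n _ n] assoc_mult_mat[of _ n n _ n _ n])
  also have "\<dots> = S * (T * U) * ?J"
    using ST U J by (simp add: exchange_mat_square right_mult_one_mat[of _ n n] mult_carrier_mat[of _ n n _ n]
        assoc_mult_mat[of _ n n _ n _ n])
  also have "\<dots> = mat_prod_list n Ts * ?J" by (simp add: Ts mat_prod_list_def U_def)
  finally show ?case
    using Hs ST J hankel_mat_exchange(1)[OF ST(1,3)] hankel_mat_exchange(2)[OF ST(2,4)]
      mult_carrier_mat[OF ST(1) J] mult_carrier_mat[OF J ST(2)]
    by (intro exI[of _ "(S * ?J) # (?J * T) # Hs"]) auto
qed

theorem theorem5p5:
  fixes n r :: nat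
  assumes "n \<ge> 1" and "r = n div 2 + 1"
  shows "(\<forall>A :: complex mat. A \<in> carrier_mat n n \<longrightarrow>
            (\<exists>Ts. length Ts = 4 * r + 1 \<and>
                  (\<forall>T \<in> set Ts. T \<in> carrier_mat n n \<and> toeplitz_mat T) \<and>
                  A = mat_prod_list n Ts)) \<and>
         (\<forall>A :: complex mat. A \<in> carrier_mat n n \<longrightarrow>
            (\<exists>Hs. length Hs = 4 * r + 1 \<and>
                  (\<forall>H \<in> set Hs. H \<in> carrier_mat n n \<and> hankel_mat H) \<and>
                  A = mat_prod_list n Hs))"
proof (intro conjI allI impI)
  fix A :: "complex mat" assume A: "A \<in> carrier_mat n n"
  then show "\<exists>Ts. length Ts = 4 * r + 1 \<and> (\<forall>T \<in> set Ts. T \<in> carrier_mat n n \<and> toeplitz_mat T) \<and>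
      A = mat_prod_list n Ts"
    using toeplitz_product_all unfolding toeplitz_product_def assms(2) by blast
next
  fix A :: "complex mat" assume A: "A \<in> carrier_mat n n"
  note J = exchange_mat_carrier[of n]
  have odd_length: "4 * r + 1 = 2 * (2 * r) + 1" by simp
  obtain Ts where Ts: "length Ts = 2 * (2 * r) + 1" "\<forall>T \<in> set Ts. T \<in> carrier_mat n n \<and> toeplitz_mat T"
    "A * exchange_mat n = mat_prod_list n Ts"
    using toeplitz_product_all[OF mult_carrier_mat[OF A J]]
    unfolding toeplitz_product_def assms(2)[symmetric] odd_length by blast
  obtain Hs where Hs: "length Hs = 2 * (2 * r) + 1" "\<forall>H \<in> set Hs. H \<in> carrier_mat n n \<and> hankel_mat H"
    "mat_prod_list n Hs = A * exchange_mat n * exchange_mat n"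
    using hankel_from_toeplitz_factors[OF Ts(1,2)] unfolding Ts(3)[symmetric] by blast
  have "A * exchange_mat n * exchange_mat n = A"
    using A J by (simp add: assoc_mult_mat[of _ n n _ n _ n] exchange_mat_square right_mult_one_mat[of _ n n])
  then show "\<exists>Hs. length Hs = 4 * r + 1 \<and> (\<forall>H \<in> set Hs. H \<in> carrier_mat n n \<and> hankel_mat H) \<and>
      A = mat_prod_list n Hs"
    using Hs by (intro exI[of _ Hs]) auto
qed

end
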